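(* Let $n\ge0$, $k\in\{2,3,4\}$ and $k\ge i\ge1$ be integers. Then \[ \sum_{n_1\geq \dots\geq n_{k-1}\geq 0} q^{n_1^2+\dots+n_{k-1}^2 + n_i+\dots +n_{k-1}} {n-\sum_{j=1}^{k-2}n_j - k +i\brack n_{k-1}}'_{q^2} \prod_{j=1}^{k-2} {2n- 2\sum_{l=1}^{j-1}n_l -n_j - n_{j+1} - 2\alpha_{ij}\brack n_j - n_{j+1}}'_q = \sum_{r=-\infty}^{\infty} (-1)^r q^{r( kr + k-i)} {2n\brack n -kr +(k-i) \frac{(-1)^r-1}{2}}_q, \] where the left sum is over integers $n_1\ge\dots\ge n_{k-1}\ge0$, empty sums are $0$ and empty products are $1$.
   Context: $\alpha_{ij}:=\max\{j-i+1,0\}$. For integers $a,b$, ${a\brack b}_q=\frac{(q;q)_a}{(q;q)_b(q;q)_{a-b}}$ if $0\le b\le a$ and $0$ otherwise, with $(x;q)_m=\prod_{j=0}^{m-1}(1-xq^j)$; ${a\brack b}'_q$ equals $1$ if $a<0$ and $b=0$, and ${a\brack b}_q$ otherwise. ${a\brack b}'_{q^2}$ is the same with $q$ replaced by $q^2$. *)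

theory Defs
  imports Main "HOL-Library.FuncSet" "HOL-Library.Groups_Big_Fun"
begin

definition q_pochhammer :: "'a::field \<Rightarrow> 'a \<Rightarrow> nat \<Rightarrow> 'a" where
  "q_pochhammer x q m = (\<Prod>j<m. 1 - x * q ^ j)"

text \<open>
  The quotient is meaningful when \<open>q\<close> is not a root of unity (this includes an indeterminate
  in a field of rational functions, and a complex number with \<open>\<bar>q\<bar> < 1\<close>): then no factor
  of the denominator vanishes.
\<close>

definition q_binomial :: "'a::field \<Rightarrow> int \<Rightarrow> int \<Rightarrow> 'a" where
  "q_binomial q a b =
     (if 0 \<le> b \<and> b \<le> a
      then q_pochhammer q q (nat a) / (q_pochhammer q q (nat b) * q_pochhammer q q (nat (a - b)))
      else 0)"

definition q_binomial' :: "'a::field \<Rightarrow> int \<Rightarrow> int \<Rightarrow> 'a" where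
  "q_binomial' q a b = (if a < 0 \<and> b = 0 then 1 else q_binomial q a b)"

definition alpha :: "int \<Rightarrow> int \<Rightarrow> int" where
  "alpha i j = max (j - i + 1) 0"

text \<open>
  Integer tuples \<open>n\<^sub>1 \<ge> \<dots> \<ge> n\<^sub>l \<ge> 0\<close>, encoded as functions on \<open>{1..l}\<close> that are
  \<open>undefined\<close> elsewhere, so that each tuple is represented exactly once.
\<close>

definition decreasing_tuples :: "int \<Rightarrow> (int \<Rightarrow> int) set" where
  "decreasing_tuples l = {m \<in> {1..l} \<rightarrow>\<^sub>E {0..}. antimono_on {1..l} m}"

text \<open>
  The constant \<open>Sum_any\<close> is the sum over the support of a function, and \<open>0\<close> if that support is
  infinite. The next two lemmas show that the supports of the two sums under consideration are
  finite.
\<close>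

lemma q_binomial_nonzeroD: "q_binomial q a b \<noteq> 0 \<Longrightarrow> 0 \<le> b \<and> b \<le> a"
  by (auto simp: q_binomial_def split: if_splits)

lemma q_binomial'_nonzeroD: "q_binomial' q a b \<noteq> 0 \<Longrightarrow> b = 0 \<or> (0 \<le> b \<and> b \<le> a)"
  by (auto simp: q_binomial'_def dest: q_binomial_nonzeroD split: if_splits)

lemma finite_support_left:
  fixes q :: "'a::field" and n k i :: int
  assumes "n \<ge> 0" "k \<ge> 2" "i \<le> k"
  shows "finite {m \<in> decreasing_tuples (k - 1).
      q_binomial' (q\<^sup>2) (n - (\<Sum>j=1..k-2. m j) - k + i) (m (k - 1)) *
      (\<Prod>j=1..k-2. q_binomial' q
         (2 * n - 2 * (\<Sum>l=1..j-1. m l) - m j - m (j + 1) - 2 * alpha i j) (m j - m (j + 1))) \<noteq> 0}"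
    (is "finite ?S")
proof (rule finite_subset)
  show "finite ({1..k-1} \<rightarrow>\<^sub>E {0..n})"
    by (intro finite_PiE) auto
  show "?S \<subseteq> {1..k-1} \<rightarrow>\<^sub>E {0..n}"
  proof
    fix m assume m: "m \<in> ?S"
    have ext: "m \<in> {1..k-1} \<rightarrow>\<^sub>E {0..}" and anti: "antimono_on {1..k-1} m"
      using m by (auto simp: decreasing_tuples_def)
    have nn: "m j \<ge> 0" if "1 \<le> j" "j \<le> k - 1" for j
      using ext that by (auto simp: PiE_iff)
    have anti': "m b \<le> m a" if "1 \<le> a" "a \<le> b" "b \<le> k - 1" for a b
      using anti that by (auto simp: monotone_on_def)
    have b1: "m (k - 1) = 0 \<or> m (k - 1) \<le> n - (\<Sum>j=1..k-2. m j) - k + i"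
      using m by (auto dest!: q_binomial'_nonzeroD)
    have b2: "m j = m (j + 1) \<or>
        m j - m (j + 1) \<le> 2 * n - 2 * (\<Sum>l=1..j-1. m l) - m j - m (j + 1) - 2 * alpha i j"
      if "1 \<le> j" "j \<le> k - 2" for j
      using m that by (auto dest!: q_binomial'_nonzeroD)
    have step: "m j = m (j + 1) \<or> m j \<le> n" if "1 \<le> j" "j \<le> k - 2" for j
    proof -
      have "(\<Sum>l=1..j-1. m l) \<ge> 0"
        using that by (intro sum_nonneg nn) auto
      moreover have "alpha i j \<ge> 0"
        by (simp add: alpha_def)
      ultimately show ?thesis
        using b2[OF that] by linarith
    qed
    have eq: "j \<le> k - 1 \<longrightarrow> m j = m 1 \<or> m 1 \<le> n" if "1 \<le> j" for j
      using that
    proof (induction j rule: int_ge_induct)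
      case (step j)
      then show ?case using \<open>1 \<le> j\<close> \<open>\<And>j. 1 \<le> j \<Longrightarrow> j \<le> k - 2 \<Longrightarrow> m j = m (j + 1) \<or> m j \<le> n\<close>[of j]
        by auto
    qed simp
    have "m (k - 1) \<le> n"
    proof -
      have "(\<Sum>j=1..k-2. m j) \<ge> 0"
        by (intro sum_nonneg nn) auto
      with b1 assms show ?thesis by linarith
    qed
    then have "m 1 \<le> n"
      using eq[of "k - 1"] assms by auto
    then have "m j \<le> n" if "1 \<le> j" "j \<le> k - 1" for j
      using anti'[of 1 j] that by simp
    then show "m \<in> {1..k-1} \<rightarrow>\<^sub>E {0..n}"
      using ext nn by (auto simp: PiE_iff)
  qed
qed

lemma finite_support_right:
  fixes q :: "'a::field" and n k i :: int
  assumes "k \<ge> 1" "1 \<le> i" "i \<le> k"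
  shows "finite {r :: int.
      q_binomial q (2 * n) (n - k * r + (k - i) * (((-1) ^ nat \<bar>r\<bar> - 1) div 2)) \<noteq> 0}"
    (is "finite ?S")
proof (rule finite_subset)
  show "finite {-(\<bar>n\<bar> + k)..\<bar>n\<bar> + k}" by simp
  show "?S \<subseteq> {-(\<bar>n\<bar> + k)..\<bar>n\<bar> + k}"
  proof
    fix r :: int assume "r \<in> ?S"
    then have b: "0 \<le> n - k * r + (k - i) * (((-1) ^ nat \<bar>r\<bar> - 1) div 2)"
      "n - k * r + (k - i) * (((-1) ^ nat \<bar>r\<bar> - 1) div 2) \<le> 2 * n"
      by (auto dest: q_binomial_nonzeroD)
    have e: "(k - i) * (((-1) ^ nat \<bar>r\<bar> - 1) div 2) \<in> {0, -(k - i)}"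
      by (cases "even (nat \<bar>r\<bar>)") auto
    have "\<bar>k * r\<bar> \<le> \<bar>n\<bar> + k"
      using b e assms by auto
    moreover have "\<bar>r\<bar> \<le> \<bar>k * r\<bar>"
      using assms by (simp add: abs_mult mult_le_cancel_right1)
    ultimately show "r \<in> {-(\<bar>n\<bar> + k)..\<bar>n\<bar> + k}" by auto
  qed
qed

end

theory Submission
  imports Defs
begin

text \<open>
  Write \<open>[a, b]\<close> for the Gaussian binomial coefficient to base \<open>q\<close>. The innermost factor is an
  alternating sum of products to base \<open>q\<close>, namely
  \<open>[N, M]\<close> to base \<open>q\<^sup>2\<close> equals \<open>\<Sum>b. (-1)\<^sup>b q powi b\<^sup>2 [N, M - b] [N, M + b]\<close>.
  Now carry out the summations over \<open>n\<^sub>k\<^sub>-\<^sub>1, \<dots>, n\<^sub>2\<close> in this order. With \<open>M = n\<^sub>j\<close>,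
  \<open>m = n\<^sub>j\<^sub>+\<^sub>1\<close> and \<open>L = n - n\<^sub>1 - \<dots> - n\<^sub>j - \<alpha>\<^sub>i\<^sub>j\<close> the factor linking consecutive variables is
  \<open>[2 L + M - m, M - m]\<close>, and the summation over \<open>m\<close> is for each \<open>b\<close> an instance of the
  q-Saalschuetz sum, which turns a product of two binomial coefficients into another such
  product. For \<open>n\<^sub>j\<close> with \<open>j \<ge> i\<close>, which carry the weight \<open>q powi (m\<^sup>2 + m)\<close>, the alternating
  sum must first be rewritten by Pascal's rule, where the surplus terms cancel in pairs. The
  last summation, over \<open>n\<^sub>1\<close>, is a q-Vandermonde sum and leaves a single binomial coefficient.
\<close>

section \<open>Gaussian binomial coefficients\<close>

text \<open>Nonzero \<open>q\<close> makes \<open>qpow_add\<close> valid for negative exponents, and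
  the second assumption keeps the denominators \<open>qf n\<close> nonzero. The base is a parameter
  because Pascal's rule is also applied to \<open>q\<^sup>2\<close>.\<close>

locale generic_base =
  fixes q :: "'a::field"
  assumes q_nonzero: "q \<noteq> 0"
    and not_root_of_unity: "m > 0 \<Longrightarrow> q ^ m \<noteq> 1"
begin

abbreviation qb :: "int \<Rightarrow> int \<Rightarrow> 'a" where
  "qb \<equiv> q_binomial q"

abbreviation qf :: "nat \<Rightarrow> 'a" where
  "qf \<equiv> q_pochhammer q q"

lemma qpow_add: "q powi (a + b) = q powi a * q powi b"
  by (simp add: power_int_add q_nonzero)

lemma qf_0 [simp]: "qf 0 = 1"
  by (simp add: q_pochhammer_def)

lemma qf_Suc: "qf (Suc n) = qf n * (1 - q ^ Suc n)"
  by (simp add: q_pochhammer_def)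

lemma qf_nonzero [simp]: "qf n \<noteq> 0"
proof (induction n)
  case (Suc n)
  have "q ^ Suc n \<noteq> 1" by (rule not_root_of_unity) simp
  with Suc show ?case by (simp add: qf_Suc del: power_Suc)
qed simp

lemma qb_eq_0: "b < 0 \<or> a < b \<Longrightarrow> qb a b = 0"
  by (auto simp: q_binomial_def)

lemma qb_negative [simp]: "a < 0 \<Longrightarrow> qb a b = 0"
  by (auto simp: q_binomial_def)

lemma qb_0 [simp]: "0 \<le> a \<Longrightarrow> qb a 0 = 1"
  by (simp add: q_binomial_def)

lemma qb_self [simp]: "0 \<le> a \<Longrightarrow> qb a a = 1"
  by (simp add: q_binomial_def)

lemma qb_nat: "qb (int (m + n)) (int m) = qf (m + n) / (qf m * qf n)"
  by (simp add: q_binomial_def nat_add_distrib)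

lemma qb_symmetric: "qb a b = qb a (a - b)"
  by (auto simp: q_binomial_def mult.commute)

text \<open>With negative upper entries giving 0, the recurrence breaks only at
  \<open>a = -1\<close>, \<open>b = 0\<close>, where the left side is 1 and the right side
  0.\<close>

lemma qb_pascal_left:
  assumes "a \<noteq> -1 \<or> b \<noteq> 0"
  shows "qb (a + 1) b = qb a (b - 1) + q powi b * qb a b"
proof -
  consider "b < 0 \<or> a + 1 < b" | "b = 0" "a < 0" | "b = 0" "a \<ge> 0" | "b = a + 1" "b > 0" | "1 \<le> b" "b \<le> a"
    by linarith
  then show ?thesis
  proof cases
    case 5
    then obtain m n where mn: "b = int (Suc m)" "a = int (Suc m + n)"
      by (metis add.commute add_diff_cancel_left' int_nat_eq less_le_trans nat_eq_iff of_nat_add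
          Suc_nat_eq_nat_zadd1 zero_less_one zle_iff_zadd Suc_pred' zero_less_imp_eq_int)
    have e1: "qb (a + 1) b = qf (Suc m + Suc n) / (qf (Suc m) * qf (Suc n))"
      using qb_nat[of "Suc m" "Suc n"] mn by (simp add: ac_simps)
    have e2: "qb a (b - 1) = qf (m + Suc n) / (qf m * qf (Suc n))"
      using qb_nat[of m "Suc n"] mn by (simp add: ac_simps)
    have e3: "qb a b = qf (Suc m + n) / (qf (Suc m) * qf n)"
      using qb_nat[of "Suc m" n] mn by simp
    have nz: "q ^ Suc m \<noteq> 1" "q ^ Suc n \<noteq> 1"
      using not_root_of_unity by blast+
    have e4: "q powi b = q ^ Suc m"
      unfolding mn power_int_of_nat ..
    have "qf (Suc m + Suc n) = qf (Suc m + n) * (1 - q ^ Suc m * q ^ Suc n)"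
      by (simp add: qf_Suc power_add ac_simps)
    moreover have "m + Suc n = Suc m + n" by simp
    ultimately show ?thesis
      unfolding e1 e2 e3 e4 using nz
      by (simp add: qf_Suc[of m] qf_Suc[of n] divide_simps del: power_Suc) (simp add: algebra_simps)
  qed (use assms in \<open>auto simp: qb_eq_0\<close>)
qed

lemma qb_pascal_right:
  assumes "a \<noteq> -1 \<or> b \<noteq> 0"
  shows "qb (a + 1) b = qb a b + q powi (a + 1 - b) * qb a (b - 1)"
proof -
  have "qb (a + 1) (a + 1 - b) = qb a (a + 1 - b - 1) + q powi (a + 1 - b) * qb a (a + 1 - b)"
    by (rule qb_pascal_left) (use assms in auto)
  moreover have "qb (a + 1) (a + 1 - b) = qb (a + 1) b"
    by (subst (2) qb_symmetric) simp
  moreover have "qb a (a + 1 - b - 1) = qb a b"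
    by (subst (2) qb_symmetric) simp
  moreover have "qb a (a + 1 - b) = qb a (b - 1)"
    by (subst (2) qb_symmetric) (simp add: algebra_simps)
  ultimately show ?thesis by simp
qed

section \<open>Summation formulas: q-Vandermonde and q-Saalschuetz\<close>

lemma q_vandermonde:
  assumes "0 \<le> a" "0 \<le> b"
  shows "(\<Sum>u=0..a. q powi (u * (b - w + u)) * qb a u * qb b (w - u)) = qb (a + b) w"
  using assms(1)
proof (induction a arbitrary: w rule: int_ge_induct)
  case base
  then show ?case by simp
next
  case (step a)
  have "(\<Sum>u=0..a+1. q powi (u * (b - w + u)) * qb (a + 1) u * qb b (w - u)) =
    (\<Sum>u=0..a+1. q powi (u * (b - w + u)) * qb a u * qb b (w - u)) +
    (\<Sum>u=0..a+1. q powi (u * (b - w + u) + (a + 1 - u)) * qb a (u - 1) * qb b (w - u))"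
    unfolding sum.distrib[symmetric]
  proof (rule sum.cong)
    fix u assume "u \<in> {0..a + 1}"
    have pascal: "qb (a + 1) u = qb a u + q powi (a + 1 - u) * qb a (u - 1)"
      by (rule qb_pascal_right) (use step.hyps in auto)
    show "q powi (u * (b - w + u)) * qb (a + 1) u * qb b (w - u) =
        q powi (u * (b - w + u)) * qb a u * qb b (w - u) +
        q powi (u * (b - w + u) + (a + 1 - u)) * qb a (u - 1) * qb b (w - u)"
      unfolding pascal qpow_add by (simp add: ring_distribs mult.assoc)
  qed simp
  also have "(\<Sum>u=0..a+1. q powi (u * (b - w + u)) * qb a u * qb b (w - u)) =
    (\<Sum>u=0..a. q powi (u * (b - w + u)) * qb a u * qb b (w - u))"
    by (rule sum.mono_neutral_right) (auto simp: qb_eq_0)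
  also have "\<dots> = qb (a + b) w"
    by (rule step.IH)
  also have "(\<Sum>u=0..a+1. q powi (u * (b - w + u) + (a + 1 - u)) * qb a (u - 1) * qb b (w - u)) =
    (\<Sum>u=1..a+1. q powi (u * (b - w + u) + (a + 1 - u)) * qb a (u - 1) * qb b (w - u))"
    by (rule sum.mono_neutral_right) (auto simp: qb_eq_0)
  \<comment> \<open>Shifting \<open>u\<close> by one turns the second Pascal part into the same sum
    for \<open>w - 1\<close>, times a power of \<open>q\<close> free of \<open>u\<close>.\<close>
  also have "\<dots> = (\<Sum>u=0..a. q powi (a + b + 1 - w + u * (b - (w - 1) + u)) * qb a u * qb b (w - 1 - u))"
    by (rule sum.reindex_bij_witness[of _ "\<lambda>u. u + 1" "\<lambda>u. u - 1"])
      (auto simp: algebra_simps)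
  also have "\<dots> = q powi (a + b + 1 - w) * qb (a + b) (w - 1)"
    by (simp only: qpow_add mult.assoc step.IH[symmetric] sum_distrib_left)
  also have "qb (a + b) w + \<dots> = qb (a + 1 + b) w"
    using qb_pascal_right[of "a + b" w] step.hyps assms(2) by (simp add: algebra_simps)
  finally show ?case .
qed

text \<open>Reindexed sums run over shifted intervals; any finite set containing the support will
  do.\<close>

lemma q_vandermonde_superset:
  assumes "0 \<le> a" "0 \<le> b" "finite U"
    and "\<And>u. 0 \<le> u \<Longrightarrow> u \<le> a \<Longrightarrow> 0 \<le> w - u \<Longrightarrow> w - u \<le> b \<Longrightarrow> u \<in> U"
  shows "(\<Sum>u\<in>U. q powi (u * (b - w + u)) * qb a u * qb b (w - u)) = qb (a + b) w"
proof -
  let ?f = "\<lambda>u. q powi (u * (b - w + u)) * qb a u * qb b (w - u)"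
  have nz: "?f u = 0" if "u \<notin> U \<or> u \<notin> {0..a}" for u
  proof (rule ccontr)
    assume "?f u \<noteq> 0"
    then have "qb a u \<noteq> 0" "qb b (w - u) \<noteq> 0" by auto
    then have "0 \<le> u \<and> u \<le> a" "0 \<le> w - u \<and> w - u \<le> b"
      by (blast dest: q_binomial_nonzeroD)+
    with that assms(4)[of u] show False by auto
  qed
  have "sum ?f U = sum ?f (U \<union> {0..a})"
    by (rule sum.mono_neutral_left) (use assms(3) in \<open>auto simp: nz\<close>)
  also have "\<dots> = sum ?f {0..a}"
    by (rule sum.mono_neutral_right) (use assms(3) in \<open>auto simp: nz\<close>)
  finally show ?thesis
    using q_vandermonde[OF assms(1,2)] by simp
qed

lemma qb_mult_cancel:
  assumes "0 \<le> c"
  shows "qb a b * qb b c = qb a c * qb (a - c) (b - c)"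
proof (cases "c \<le> b \<and> b \<le> a")
  case True
  with assms show ?thesis by (simp add: q_binomial_def)
qed (use assms in \<open>auto simp: qb_eq_0 not_le\<close>)

text \<open>For \<open>c \<le> b\<close> both products are the q-multinomial coefficient with top
  \<open>b + m\<close> and parts \<open>m - j\<close>, \<open>c + j\<close>, \<open>b - c\<close>;
  otherwise both vanish.\<close>

lemma qb_mult_swap:
  assumes "0 \<le> j" "j \<le> m" "0 \<le> c"
  shows "qb (m + c) (m - j) * qb (b + m) (m + c) = qb (b + m) (m - j) * qb (b + j) (c + j)"
proof (cases "c \<le> b")
  case True
  have "qb (m + c) (m - j) = qf (nat (m + c)) / (qf (nat (m - j)) * qf (nat (c + j)))"
    and "qb (b + m) (m + c) = qf (nat (b + m)) / (qf (nat (m + c)) * qf (nat (b - c)))"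
    and "qb (b + m) (m - j) = qf (nat (b + m)) / (qf (nat (m - j)) * qf (nat (b + j)))"
    and "qb (b + j) (c + j) = qf (nat (b + j)) / (qf (nat (c + j)) * qf (nat (b - c)))"
    using True assms by (simp_all add: q_binomial_def)
  then show ?thesis by simp
qed (use assms in \<open>auto simp: qb_eq_0 not_le\<close>)

text \<open>Three uses of q-Vandermonde: it expands the first factor on the right as a sum over
  \<open>j\<close>, then \<open>qb (b + j) (c + j)\<close> as a sum over \<open>i\<close>; after
  exchanging the sums, it evaluates the sum over \<open>j\<close>.\<close>

lemma q_saalschuetz_aux:
  assumes "0 \<le> a" "0 \<le> b" "0 \<le> c" "0 \<le> m"
  shows "(\<Sum>i=0..m. q powi (i * (i + c)) * qb (a + b + m - i) (m - i) * qb a i * qb b (i + c)) =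
    qb (a + m + c) m * qb (b + m) (m + c)"
proof -
  have "qb (a + (m + c)) m = (\<Sum>j=0..m. q powi (j * (m + c - m + j)) * qb a j * qb (m + c) (m - j))"
    by (rule q_vandermonde_superset[symmetric]) (use assms in auto)
  then have "qb (a + m + c) m * qb (b + m) (m + c) =
      (\<Sum>j=0..m. q powi (j * (j + c)) * qb a j * (qb (m + c) (m - j) * qb (b + m) (m + c)))"
    by (simp add: sum_distrib_left sum_distrib_right mult_ac add_ac)
  also have "\<dots> = (\<Sum>j=0..m. q powi (j * (j + c)) * qb a j * qb (b + m) (m - j) *
      (\<Sum>i=0..m. q powi ((j - i) * (b - c - i)) * qb j i * qb b (i + c)))"
  proof (rule sum.cong)
    fix j assume j: "j \<in> {0..m}"
    have "qb (j + b) (c + j) = (\<Sum>u\<in>{j-m..j}. q powi (u * (b - (c + j) + u)) * qb j u * qb b (c + j - u))"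
      by (rule q_vandermonde_superset[symmetric]) (use assms j in auto)
    also have "\<dots> = (\<Sum>i=0..m. q powi ((j - i) * (b - c - i)) * qb j (j - i) * qb b (i + c))"
      by (rule sum.reindex_bij_witness[of _ "\<lambda>i. j - i" "\<lambda>u. j - u"])
        (auto simp: algebra_simps)
    finally have "qb (b + j) (c + j) =
        (\<Sum>i=0..m. q powi ((j - i) * (b - c - i)) * qb j i * qb b (i + c))"
      by (simp only: qb_symmetric[symmetric] add.commute[of b j])
    then show "q powi (j * (j + c)) * qb a j * (qb (m + c) (m - j) * qb (b + m) (m + c)) =
      q powi (j * (j + c)) * qb a j * qb (b + m) (m - j) *
      (\<Sum>i=0..m. q powi ((j - i) * (b - c - i)) * qb j i * qb b (i + c))"
      using j assms by (simp add: qb_mult_swap mult.assoc)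
  qed simp
  also have "\<dots> = (\<Sum>i=0..m. \<Sum>j=0..m. q powi (j * (j + c)) * qb a j * qb (b + m) (m - j) *
      (q powi ((j - i) * (b - c - i)) * qb j i * qb b (i + c)))"
    unfolding sum_distrib_left by (rule sum.swap)
  also have "\<dots> = (\<Sum>i=0..m. q powi (i * (i + c)) * qb (a + b + m - i) (m - i) * qb a i * qb b (i + c))"
  proof (rule sum.cong)
    fix i assume i: "i \<in> {0..m}"
    show "(\<Sum>j=0..m. q powi (j * (j + c)) * qb a j * qb (b + m) (m - j) *
        (q powi ((j - i) * (b - c - i)) * qb j i * qb b (i + c))) =
      q powi (i * (i + c)) * qb (a + b + m - i) (m - i) * qb a i * qb b (i + c)"
    proof (cases "i \<le> a")
      case True
      have "qb (a - i + (b + m)) (m - i) = (\<Sum>u\<in>{-i..m-i}. q powi (u * (b + m - (m - i) + u)) *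
          qb (a - i) u * qb (b + m) (m - i - u))"
        by (rule q_vandermonde_superset[symmetric]) (use assms i True in auto)
      also have "\<dots> = (\<Sum>j=0..m. q powi ((j - i) * (b + j)) * qb (a - i) (j - i) * qb (b + m) (m - j))"
        by (rule sum.reindex_bij_witness[of _ "\<lambda>j. j - i" "\<lambda>u. u + i"]) (auto simp: algebra_simps)
      finally have v: "qb (a + b + m - i) (m - i) =
          (\<Sum>j=0..m. q powi ((j - i) * (b + j)) * qb (a - i) (j - i) * qb (b + m) (m - j))"
        by (simp add: algebra_simps)
      have "q powi (i * (i + c)) * qb (a + b + m - i) (m - i) * qb a i * qb b (i + c) =
        (\<Sum>j=0..m. (q powi (i * (i + c)) * q powi ((j - i) * (b + j))) * (qb a i * qb (a - i) (j - i)) *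
          qb (b + m) (m - j) * qb b (i + c))"
        unfolding v sum_distrib_left sum_distrib_right by (simp only: mult_ac)
      also have "\<dots> = (\<Sum>j=0..m. q powi (j * (j + c)) * qb a j * qb (b + m) (m - j) *
        (q powi ((j - i) * (b - c - i)) * qb j i * qb b (i + c)))"
      proof (rule sum.cong)
        fix j
        have "q powi (i * (i + c)) * q powi ((j - i) * (b + j)) =
            q powi (j * (j + c)) * q powi ((j - i) * (b - c - i))"
          unfolding qpow_add[symmetric] by (simp add: algebra_simps)
        moreover have "qb a i * qb (a - i) (j - i) = qb a j * qb j i"
          by (rule qb_mult_cancel[symmetric]) (use i in auto)
        ultimately show "(q powi (i * (i + c)) * q powi ((j - i) * (b + j))) *
            (qb a i * qb (a - i) (j - i)) * qb (b + m) (m - j) * qb b (i + c) =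
          q powi (j * (j + c)) * qb a j * qb (b + m) (m - j) *
            (q powi ((j - i) * (b - c - i)) * qb j i * qb b (i + c))"
          by (simp only: mult_ac)
      qed simp
      finally show ?thesis ..
    next
      case False
      \<comment> \<open>Since \<open>i > a\<close>, either \<open>j > a\<close> or
        \<open>j < i\<close>, so one factor vanishes.\<close>
      have *: "q powi (j * (j + c)) * qb a j * qb (b + m) (m - j) *
        (q powi ((j - i) * (b - c - i)) * qb j i * qb b (i + c)) = 0" for j
        by (cases "a < j") (use False in \<open>simp_all add: qb_eq_0\<close>)
      show ?thesis unfolding * using False by (simp add: qb_eq_0)
    qed
  qed simp
  finally show ?thesis ..
qed

text \<open>
  The hypotheses on \<open>d + c\<close> make both sides zero when \<open>a\<close> or \<open>b\<close> is negative; the last hypothesis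
  excludes nonzero terms with negative \<open>i\<close>.
\<close>

lemma q_saalschuetz:
  assumes "0 \<le> a \<or> d + c \<le> 0" "0 \<le> b \<or> 0 \<le> d + c" "0 \<le> m" "0 \<le> d \<or> c \<le> 0"
  shows "(\<Sum>i=0..m. q powi ((i - d) * (i + c)) * qb (a + b + m - i) (m - i) *
      qb a (i - d) * qb b (i + c)) = qb (a + m + c) (m - d) * qb (b + m - d) (m + c)"
proof -
  \<comment> \<open>Replacing \<open>i\<close> by \<open>i + d\<close> reduces this case to
    \<open>q_saalschuetz_aux\<close> with \<open>m - d\<close> and \<open>c + d\<close>.\<close>
  have shifted: "(\<Sum>i=0..m. q powi ((i - d) * (i + c)) * qb (a + b + m - i) (m - i) *
      qb a (i - d) * qb b (i + c)) = qb (a + m + c) (m - d) * qb (b + m - d) (m + c)"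
    if "0 \<le> a" "0 \<le> b" "0 \<le> d + c" "0 \<le> d" for a b c d
  proof (cases "d \<le> m")
    case True
    have "(\<Sum>i=0..m. q powi ((i - d) * (i + c)) * qb (a + b + m - i) (m - i) *
        qb a (i - d) * qb b (i + c)) =
      (\<Sum>i=d..m. q powi ((i - d) * (i + c)) * qb (a + b + m - i) (m - i) * qb a (i - d) * qb b (i + c))"
      by (rule sum.mono_neutral_right) (use that in \<open>auto simp: qb_eq_0\<close>)
    also have "\<dots> = (\<Sum>i=0..m-d. q powi (i * (i + (c + d))) * qb (a + b + (m - d) - i) (m - d - i) *
        qb a i * qb b (i + (c + d)))"
      by (rule sum.reindex_bij_witness[of _ "\<lambda>i. i + d" "\<lambda>i. i - d"]) (auto simp: algebra_simps)
    also have "\<dots> = qb (a + (m - d) + (c + d)) (m - d) * qb (b + (m - d)) (m - d + (c + d))"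
      by (rule q_saalschuetz_aux) (use that True in auto)
    finally show ?thesis by (simp add: algebra_simps)
  next
    case False
    then show ?thesis by (simp add: qb_eq_0)
  qed
  consider "0 \<le> a" "0 \<le> b" "0 \<le> d + c" | "0 \<le> a" "0 \<le> b" "d + c < 0" | "a < 0" | "b < 0"
    by linarith
  then show ?thesis
  proof cases
    case 1
    then show ?thesis using shifted[of a b d c] assms by linarith
  next
    case 2
    \<comment> \<open>Exchanging the two factors replaces \<open>a, b, d, c\<close> by
      \<open>b, a, -c, -d\<close>, which makes the sum of the shifts positive.\<close>
    have "(\<Sum>i=0..m. q powi ((i - (-c)) * (i + (-d))) * qb (b + a + m - i) (m - i) *
        qb b (i - (-c)) * qb a (i + (-d))) = qb (b + m + (-d)) (m - (-c)) * qb (a + m - (-c)) (m + (-d))"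
      by (rule shifted) (use 2 assms in auto)
    then show ?thesis by (simp add: mult_ac add_ac add_diff_eq)
  next
    case 3
    with assms show ?thesis
      by (cases "m - d \<le> a + m + c") (auto simp: qb_eq_0)
  next
    case 4
    with assms show ?thesis
      by (cases "m + c \<le> b + m - d") (auto simp: qb_eq_0)
  qed
qed

text \<open>Reflecting \<open>qb b (i + c)\<close> gives a q-Vandermonde sum. The third hypothesis
  excludes nonzero terms with \<open>i < 0\<close>, the last one those with \<open>i > m\<close>: a
  nonzero term has \<open>2 * i \<le> a + b + d - c\<close>.\<close>

lemma q_vandermonde_centred:
  assumes "0 \<le> a \<or> d + c \<le> 0" "0 \<le> b \<or> 0 \<le> d + c" "0 \<le> d \<or> c \<le> 0" "a + b + d - c \<le> 2 * m + 1"
  shows "(\<Sum>i=0..m. q powi ((i - d) * (i + c)) * qb a (i - d) * qb b (i + c)) = qb (a + b) (b - d - c)"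
proof (cases "0 \<le> a \<and> 0 \<le> b")
  case True
  have "qb (a + b) (b - d - c) = (\<Sum>u\<in>{-d..m-d}. q powi (u * (b - (b - d - c) + u)) * qb a u *
      qb b (b - d - c - u))"
    by (rule q_vandermonde_superset[symmetric]) (use True assms in auto)
  also have "\<dots> = (\<Sum>i=0..m. q powi ((i - d) * (i + c)) * qb a (i - d) * qb b (b - (i + c)))"
    by (rule sum.reindex_bij_witness[of _ "\<lambda>i. i - d" "\<lambda>u. u + d"]) (auto simp: algebra_simps)
  finally show ?thesis
    by (simp only: qb_symmetric[symmetric])
next
  case False
  with assms show ?thesis
    by (auto simp: qb_eq_0)
qed

end

section \<open>Alternating sums over all integers\<close>

text \<open>Even and odd indices cancel in pairs. Since \<open>I\<close> may fail to be closed under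
  \<open>f\<close>, the pairing takes place on its closure \<open>J\<close>.\<close>

lemma sum_parity_involution_eq_0:
  fixes h :: "int \<Rightarrow> 'b::ab_group_add"
  assumes "finite I" and inv: "\<And>b. f (f b) = b" and parity: "\<And>b. even (f b) \<longleftrightarrow> odd b"
    and anti: "\<And>b. h (f b) = - h b" and supp: "\<And>b. b \<notin> I \<Longrightarrow> h b = 0"
  shows "sum h I = 0"
proof -
  define J where "J = I \<union> f ` I"
  have "finite J" using assms(1) by (simp add: J_def)
  have fJ: "f b \<in> J" if "b \<in> J" for b
    using that inv by (auto simp: J_def)
  have "sum h I = sum h J"
    by (rule sum.mono_neutral_left) (use \<open>finite J\<close> supp in \<open>auto simp: J_def\<close>)
  also have "\<dots> = sum h {b \<in> J. even b} + sum h {b \<in> J. odd b}"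
    using \<open>finite J\<close> by (subst sum.union_disjoint[symmetric]) (auto intro: sum.cong)
  also have "sum h {b \<in> J. odd b} = (\<Sum>b\<in>{b \<in> J. even b}. - h b)"
    by (rule sum.reindex_bij_witness[of _ f f]) (use inv parity anti fJ in \<open>auto\<close>)
  finally show ?thesis by (simp add: sum_negf)
qed

text \<open>The difference \<open>b - even_ceil b\<close> equals ((-1)^b - 1)/2, the parity term in
  the lower entry on the right side of the identity.\<close>

definition even_ceil :: "int \<Rightarrow> int" where
  "even_ceil b = (if even b then b else b + 1)"

lemma even_ceil_reflect: "even_ceil (-1 - b) = - even_ceil b"
  by (simp add: even_ceil_def)

lemma even_ceil_nonneg: "0 \<le> b \<Longrightarrow> 0 \<le> even_ceil b"
  by (simp add: even_ceil_def)

lemma even_ceil_nonpos: "b \<le> 0 \<Longrightarrow> even_ceil b \<le> 0"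
  by (auto simp: even_ceil_def) presburger

lemma product_difference_right: "c * e * x * (y + f * z) - c * e * x * y = c * (e * f) * (x * z)"
  and product_difference_left: "c * e * (x + f * z) * y - c * e * x * y = c * (e * f) * (z * y)"
  for c e f x y z :: "'a::comm_ring"
  by (simp_all add: algebra_simps)

lemma product_rearrange: "p * e = e' * p' \<Longrightarrow> p * r * (c * e * x * y) = c * e' * (p' * r * x * y)"
  and product_rearrange_final: "p * e = e' * p' \<Longrightarrow> p * (c * e * x * y) = c * e' * (p' * x * y)"
  for c e e' p p' r x y :: "'a::comm_ring"
  by (metis mult.assoc mult.commute)+

context generic_base
begin

definition alt :: "int \<Rightarrow> 'a" where
  "alt b = (if even b then 1 else -1)"

text \<open>
  The finite index set \<open>I\<close> only has to contain the support of the summand, so that these are sums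
  over all integers.
\<close>

definition bosonic :: "int set \<Rightarrow> int \<Rightarrow> int \<Rightarrow> int \<Rightarrow> int \<Rightarrow> 'a" where
  "bosonic I s t N M = (\<Sum>b\<in>I. alt b * q powi ((s + t + 1) * b\<^sup>2 + s * b) *
     qb (N + s * even_ceil b + t * b) (M - b) * qb (N - s * even_ceil b - t * b) (M + b))"

text \<open>
  Two rewritings of \<open>bosonic I s 0 N M\<close> in which the lower entries add up to \<open>2 * M + 1\<close>, as needed
  for a summation against \<open>q powi (M\<^sup>2 + M)\<close>: the first one comes out of the q-Saalschuetz
  sum, the second one has the upper entries required to put it into the next such sum.
\<close>

definition bosonic_out :: "int set \<Rightarrow> int \<Rightarrow> int \<Rightarrow> int \<Rightarrow> 'a" where
  "bosonic_out I s N M = (\<Sum>b\<in>I. alt b * q powi ((s + 1) * b\<^sup>2 + s * b) *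
     qb (N + s * even_ceil b) (M - b) * qb (N + 1 - s * even_ceil b) (M + b + 1))"

definition bosonic_in :: "int set \<Rightarrow> int \<Rightarrow> int \<Rightarrow> int \<Rightarrow> 'a" where
  "bosonic_in I s N M = (\<Sum>b\<in>I. alt b * q powi ((s + 1) * b\<^sup>2 + s * b) *
     qb (N + s * even_ceil b + (even_ceil b - b)) (M - b) *
     qb (N + 2 - s * even_ceil b - (even_ceil b - b)) (M + b + 1))"

section \<open>Cancellation of surplus terms, and the Gaussian binomial to base
  \<open>q\<^sup>2\<close>\<close>

lemma alt_reflect: "odd c \<Longrightarrow> alt (c - b) = - alt b"
  by (auto simp: alt_def)

text \<open>Pascal's rule on the second factor leaves the surplus \<open>h\<close>. The map
  \<open>b \<mapsto> -1 - b\<close> negates \<open>even_ceil b\<close>, hence swaps the two factors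
  of \<open>h\<close>; it fixes the exponent and flips the sign.\<close>

lemma bosonic_out_eq:
  assumes "0 \<le> N" "0 \<le> s" "finite I" "{-M-2..M+2} \<subseteq> I"
  shows "bosonic_out I s N M = bosonic I s 0 N M"
proof -
  define h where "h b = alt b * q powi ((s + 1) * b\<^sup>2 + (s + 1) * b + (M + 1)) *
    (qb (N + s * even_ceil b) (M - b) * qb (N - s * even_ceil b) (M + b + 1))" for b
  have "bosonic_out I s N M - bosonic I s 0 N M = sum h I"
    unfolding bosonic_out_def bosonic_def sum_subtractf[symmetric]
  proof (rule sum.cong)
    fix b
    have "s * even_ceil b \<le> 0" if "b \<le> 0"
      using even_ceil_nonpos[OF that] assms(2) by (simp add: mult_nonneg_nonpos)
    \<comment> \<open>The exceptional case of Pascal's rule would need \<open>b > 0\<close> and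
      \<open>M = -b - 1\<close>; then \<open>M < b\<close> and the factor with lower entry
      \<open>M - b\<close> vanishes.\<close>
    then have "N - s * even_ceil b + 1 \<noteq> 0 \<or> M + b + 1 \<noteq> 0 \<or> M < b"
      using assms(1) by (cases "b \<le> 0") auto
    then consider "N - s * even_ceil b \<noteq> -1 \<or> M + b + 1 \<noteq> 0" | "M - b < 0"
      by force
    then show "alt b * q powi ((s + 1) * b\<^sup>2 + s * b) *
        qb (N + s * even_ceil b) (M - b) * qb (N + 1 - s * even_ceil b) (M + b + 1) -
      alt b * q powi ((s + 0 + 1) * b\<^sup>2 + s * b) *
        qb (N + s * even_ceil b + 0 * b) (M - b) * qb (N - s * even_ceil b - 0 * b) (M + b) = h b"
    proof cases
      case 1
      then have pascal: "qb (N + 1 - s * even_ceil b) (M + b + 1) = qb (N - s * even_ceil b) (M + b) +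
          q powi (M + b + 1) * qb (N - s * even_ceil b) (M + b + 1)"
        using qb_pascal_left[of "N - s * even_ceil b" "M + b + 1"] by (simp add: algebra_simps)
      have "q powi ((s + 1) * b\<^sup>2 + (s + 1) * b + (M + 1)) =
          q powi ((s + 1) * b\<^sup>2 + s * b) * q powi (M + b + 1)"
        unfolding qpow_add[symmetric] by (simp add: algebra_simps)
      then show ?thesis
        using product_difference_right by (simp add: h_def pascal)
    next
      case 2
      then show ?thesis by (simp add: h_def qb_eq_0)
    qed
  qed simp
  also have "sum h I = 0"
  proof (rule sum_parity_involution_eq_0[where f = "\<lambda>b. -1 - b"])
    show "h (-1 - b) = - h b" for b
      by (simp add: h_def even_ceil_reflect alt_reflect) (simp add: algebra_simps power2_eq_square)
    show "h b = 0" if "b \<notin> I" for b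
    proof -
      from that assms(4) have "b \<notin> {-M-2..M+2}" by blast
      then have "b < -M - 2 \<or> M + 2 < b" by auto
      then show ?thesis by (auto simp: h_def qb_eq_0)
    qed
  qed (use assms(3) in auto)
  finally show ?thesis by simp
qed

text \<open>Compared with \<open>bosonic_out\<close>, an even \<open>b\<close> has its second upper
  entry raised by one, an odd \<open>b\<close> its first. Pascal's rule gives the surplus
  \<open>g b\<close> for even \<open>b\<close> and \<open>- g (b + 1)\<close> for odd
  \<open>b\<close>, so each odd index cancels against its successor.\<close>

lemma bosonic_in_eq:
  assumes "0 \<le> N" "0 \<le> s" "finite I" "{-M-2..M+2} \<subseteq> I"
  shows "bosonic_in I s N M = bosonic I s 0 N M"
proof -
  define g where "g b = q powi ((s + 1) * b\<^sup>2 - b + (N + 1 - M)) *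
    (qb (N + s * b) (M - b) * qb (N + 1 - s * b) (M + b))" for b
  define h where "h b = (if even b then g b else - g (b + 1))" for b
  have "bosonic_in I s N M - bosonic_out I s N M = sum h I"
    unfolding bosonic_out_def bosonic_in_def sum_subtractf[symmetric]
  proof (rule sum.cong)
    fix b
    show "alt b * q powi ((s + 1) * b\<^sup>2 + s * b) *
        qb (N + s * even_ceil b + (even_ceil b - b)) (M - b) *
        qb (N + 2 - s * even_ceil b - (even_ceil b - b)) (M + b + 1) -
      alt b * q powi ((s + 1) * b\<^sup>2 + s * b) *
        qb (N + s * even_ceil b) (M - b) * qb (N + 1 - s * even_ceil b) (M + b + 1) = h b"
    proof (cases "even b")
      case True
      have "s * b \<le> 0" if "b \<le> 0"
        using that assms(2) by (simp add: mult_nonneg_nonpos)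
      then consider "N + 1 - s * b \<noteq> -1 \<or> M + b + 1 \<noteq> 0" | "M - b < 0"
        using assms(1) by (cases "b \<le> 0") force+
      then show ?thesis
      proof cases
        case 1
        then have pascal: "qb (N + 2 - s * b) (M + b + 1) = qb (N + 1 - s * b) (M + b + 1) +
            q powi (N + 1 - s * b - M - b) * qb (N + 1 - s * b) (M + b)"
          using qb_pascal_right[of "N + 1 - s * b" "M + b + 1"] by (simp add: algebra_simps)
        have "q powi ((s + 1) * b\<^sup>2 - b + (N + 1 - M)) =
            q powi ((s + 1) * b\<^sup>2 + s * b) * q powi (N + 1 - s * b - M - b)"
          unfolding qpow_add[symmetric] by (simp add: algebra_simps)
        then have "h b = alt b * (q powi ((s + 1) * b\<^sup>2 + s * b) * q powi (N + 1 - s * b - M - b)) *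
            (qb (N + s * b) (M - b) * qb (N + 1 - s * b) (M + b))"
          using True by (simp add: h_def g_def alt_def)
        moreover have "even_ceil b = b" using True by (simp add: even_ceil_def)
        ultimately show ?thesis
          by (simp only: diff_self diff_zero add_0_right pascal product_difference_right)
      next
        case 2
        then show ?thesis by (simp add: h_def g_def True even_ceil_def qb_eq_0)
      qed
    next
      case False
      have "0 \<le> s * (b + 1)" if "0 \<le> b"
        using that assms(2) by simp
      \<comment> \<open>The exceptional case of Pascal's rule has \<open>M = b < 0\<close>, which
        makes the other lower entry negative.\<close>
      then consider "N + s * (b + 1) \<noteq> -1 \<or> M - b \<noteq> 0" | "M + b + 1 < 0"
        using assms(1) by (cases "0 \<le> b") force+
      then show ?thesis
      proof cases
        case 1
        then have pascal: "qb (N + s * (b + 1) + 1) (M - b) = qb (N + s * (b + 1)) (M - b) +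
            q powi (N + s * (b + 1) + 1 - M + b) * qb (N + s * (b + 1)) (M - (b + 1))"
          using qb_pascal_right[of "N + s * (b + 1)" "M - b"] by (simp add: algebra_simps)
        have "q powi ((s + 1) * (b + 1)\<^sup>2 - (b + 1) + (N + 1 - M)) =
            q powi ((s + 1) * b\<^sup>2 + s * b) * q powi (N + s * (b + 1) + 1 - M + b)"
          unfolding qpow_add[symmetric] by (simp add: algebra_simps power2_eq_square)
        then have "h b = alt b * (q powi ((s + 1) * b\<^sup>2 + s * b) * q powi (N + s * (b + 1) + 1 - M + b)) *
            (qb (N + s * (b + 1)) (M - (b + 1)) * qb (N + 1 - s * (b + 1)) (M + b + 1))"
          using False by (simp add: h_def g_def alt_def add.assoc)
        moreover have "even_ceil b = b + 1" using False by (simp add: even_ceil_def)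
        moreover have "N + 2 - s * (b + 1) - (b + 1 - b) = N + 1 - s * (b + 1)"
          "N + s * (b + 1) + (b + 1 - b) = N + s * (b + 1) + 1" by auto
        ultimately show ?thesis
          by (simp only: pascal product_difference_left)
      next
        case 2
        then show ?thesis by (simp add: h_def g_def False even_ceil_def qb_eq_0)
      qed
    qed
  qed simp
  also have "sum h I = 0"
  proof (rule sum_parity_involution_eq_0[where f = "\<lambda>b. if even b then b - 1 else b + 1"])
    show "h b = 0" if "b \<notin> I" for b
    proof -
      from that assms(4) have "b \<notin> {-M-2..M+2}" by blast
      then have "b < -M - 2 \<or> M + 2 < b" by auto
      then show ?thesis by (auto simp: h_def g_def qb_eq_0)
    qed
  qed (use assms(3) in \<open>auto simp: h_def\<close>)
  finally show ?thesis
    using bosonic_out_eq[OF assms] by simp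
qed

text \<open>This is Pascal's rule to base \<open>q\<^sup>2\<close>. Applying the rule to base
  \<open>q\<close> in both factors gives \<open>bosonic_out\<close> at \<open>M - 1\<close>, the
  wanted last term, and a mixed term \<open>h\<close> that is antisymmetric under
  \<open>b \<mapsto> 1 - b\<close>.\<close>

lemma bosonic_Suc:
  assumes "0 \<le> N" "finite I" "{-M-2..M+2} \<subseteq> I"
  shows "bosonic I 0 0 (N + 1) M = bosonic I 0 0 N (M - 1) + q powi (2 * M) * bosonic I 0 0 N M"
proof -
  define h where "h b = alt b * q powi (b\<^sup>2 - b) * (qb N (M - b) * qb N (M + b - 1))" for b
  have "bosonic I 0 0 (N + 1) M =
    (\<Sum>b\<in>I. alt b * q powi b\<^sup>2 * qb N (M - 1 - b) * qb (N + 1) (M - 1 + b + 1) + q powi M * h b +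
      q powi (2 * M) * (alt b * q powi b\<^sup>2 * qb N (M - b) * qb N (M + b)))"
    unfolding bosonic_def
  proof (rule sum.cong)
    fix b
    have 1: "qb (N + 1) (M - b) = qb N (M - 1 - b) + q powi (M - b) * qb N (M - b)"
      using qb_pascal_left[of N "M - b"] assms(1) by (simp add: algebra_simps)
    have 2: "qb (N + 1) (M + b) = qb N (M + b - 1) + q powi (M + b) * qb N (M + b)"
      using qb_pascal_left[of N "M + b"] assms(1) by (simp add: algebra_simps)
    have 3: "q powi M * q powi (b\<^sup>2 - b) = q powi b\<^sup>2 * q powi (M - b)"
      "q powi (2 * M) = q powi (M - b) * q powi (M + b)"
      unfolding qpow_add[symmetric] by (simp_all add: algebra_simps)
    have "qb (N + 1) (M - b) * qb (N + 1) (M + b) = qb N (M - 1 - b) * qb (N + 1) (M + b) +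
        q powi (M - b) * qb N (M - b) * (qb N (M + b - 1) + q powi (M + b) * qb N (M + b))"
      unfolding 1 2[symmetric] by (rule distrib_right)
    then have "alt b * q powi b\<^sup>2 * qb (N + 1) (M - b) * qb (N + 1) (M + b) =
      alt b * q powi b\<^sup>2 * qb N (M - 1 - b) * qb (N + 1) (M + b) +
      alt b * (q powi b\<^sup>2 * q powi (M - b)) * qb N (M - b) * qb N (M + b - 1) +
      (q powi (M - b) * q powi (M + b)) * (alt b * q powi b\<^sup>2 * qb N (M - b) * qb N (M + b))"
      by (simp add: ring_distribs mult_ac)
    also have "\<dots> = alt b * q powi b\<^sup>2 * qb N (M - 1 - b) * qb (N + 1) (M - 1 + b + 1) + q powi M * h b +
      q powi (2 * M) * (alt b * q powi b\<^sup>2 * qb N (M - b) * qb N (M + b))"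
      unfolding 3[symmetric] h_def by (simp add: mult_ac)
    finally show "alt b * q powi ((0 + 0 + 1) * b\<^sup>2 + 0 * b) * qb (N + 1 + 0 * even_ceil b + 0 * b) (M - b) *
        qb (N + 1 - 0 * even_ceil b - 0 * b) (M + b) =
      alt b * q powi b\<^sup>2 * qb N (M - 1 - b) * qb (N + 1) (M - 1 + b + 1) + q powi M * h b +
      q powi (2 * M) * (alt b * q powi b\<^sup>2 * qb N (M - b) * qb N (M + b))"
      by simp
  qed simp
  also have "\<dots> = bosonic_out I 0 N (M - 1) + q powi M * sum h I + q powi (2 * M) * bosonic I 0 0 N M"
    by (simp add: sum.distrib sum_distrib_left bosonic_def bosonic_out_def)
  also have "sum h I = 0"
  proof (rule sum_parity_involution_eq_0[where f = "\<lambda>b. 1 - b"])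
    show "h (1 - b) = - h b" for b
      by (simp add: h_def alt_reflect) (simp add: algebra_simps power2_eq_square)
    show "h b = 0" if "b \<notin> I" for b
    proof -
      from that assms(3) have "b \<notin> {-M-2..M+2}" by blast
      then have "b < -M - 2 \<or> M + 2 < b" by auto
      then show ?thesis by (auto simp: h_def qb_eq_0)
    qed
  qed (use assms(2) in auto)
  also have "bosonic_out I 0 N (M - 1) = bosonic I 0 0 N (M - 1)"
    by (rule bosonic_out_eq) (use assms in auto)
  finally show ?thesis by simp
qed

lemma generic_base_square: "generic_base (q\<^sup>2)"
  by unfold_locales (use q_nonzero not_root_of_unity in \<open>auto simp: power_mult[symmetric]\<close>)

lemma bosonic_base:
  assumes "0 \<le> N" "finite I" "{-M-2..M+2} \<subseteq> I"
  shows "bosonic I 0 0 N M = q_binomial (q\<^sup>2) N M"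
  using assms(1,3)
proof (induction N arbitrary: M rule: int_ge_induct)
  case base
  show ?case
  proof (cases "M = 0")
    case True
    with base have "0 \<in> I" by auto
    have "bosonic I 0 0 0 0 = (\<Sum>b\<in>I. if b = 0 then 1 else 0)"
      unfolding bosonic_def by (rule sum.cong) (auto simp: alt_def qb_eq_0 linorder_neq_iff)
    with True \<open>0 \<in> I\<close> assms(2) show ?thesis
      by (simp add: q_binomial_def q_pochhammer_def)
  next
    case False
    have "qb 0 (M - b) * qb 0 (M + b) = 0" for b
      using False by (cases "M = b") (auto simp: qb_eq_0 linorder_neq_iff)
    then have "bosonic I 0 0 0 M = 0"
      unfolding bosonic_def by (intro sum.neutral) (simp add: mult.assoc)
    with False show ?thesis by (auto simp: q_binomial_def)
  qed
next
  case (step N)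
  interpret sq: generic_base "q\<^sup>2" by (rule generic_base_square)
  have "bosonic I 0 0 (N + 1) M = bosonic I 0 0 N (M - 1) + q powi (2 * M) * bosonic I 0 0 N M"
    by (rule bosonic_Suc) (use step assms in auto)
  also have "bosonic I 0 0 N (M - 1) = q_binomial (q\<^sup>2) N (M - 1)"
    by (rule step.IH) (use step.prems in auto)
  also have "bosonic I 0 0 N M = q_binomial (q\<^sup>2) N M"
    by (rule step.IH) (rule step.prems)
  also have "q powi (2 * M) = (q\<^sup>2) powi M"
    by (simp add: power_int_mult)
  also have "q_binomial (q\<^sup>2) N (M - 1) + (q\<^sup>2) powi M * q_binomial (q\<^sup>2) N M = q_binomial (q\<^sup>2) (N + 1) M"
    by (rule sq.qb_pascal_left[symmetric]) (use step.hyps in auto)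
  finally show ?case .
qed

section \<open>Summing out one variable of an alternating sum\<close>

lemma shift_nonneg:
  assumes "0 \<le> s" "0 \<le> t" "0 \<le> b"
  shows "0 \<le> s * even_ceil b + t * b"
  using assms even_ceil_nonneg[of b] by simp

lemma shift_nonpos:
  assumes "0 \<le> s" "0 \<le> t" "b \<le> 0"
  shows "s * even_ceil b + t * b \<le> 0"
  using assms even_ceil_nonpos[of b] by (simp add: add_nonpos_nonpos mult_nonneg_nonpos)

text \<open>For each \<open>b\<close>, writing m^2 = (m - b)(m + b) + b^2 gives q-Saalschuetz with
  upper entries \<open>L + ?x b\<close>, \<open>L - ?x b\<close> and both shifts equal to
  \<open>b\<close>. As \<open>?x b\<close> has the sign of \<open>b\<close>, its sign hypotheses
  hold. The result adds \<open>b\<close> to the shift, so \<open>t\<close> grows by one.\<close>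

lemma bosonic_step:
  assumes "0 \<le> L" "0 \<le> M" "0 \<le> s" "0 \<le> t"
  shows "(\<Sum>m=0..M. q powi m\<^sup>2 * qb (2 * L + M - m) (M - m) * bosonic I s t L m) =
    bosonic I s (t + 1) (L + M) M"
proof -
  let ?x = "\<lambda>b. s * even_ceil b + t * b"
  have "(\<Sum>m=0..M. q powi m\<^sup>2 * qb (2 * L + M - m) (M - m) * bosonic I s t L m) =
    (\<Sum>b\<in>I. \<Sum>m=0..M. q powi m\<^sup>2 * qb (2 * L + M - m) (M - m) *
      (alt b * q powi ((s + t + 1) * b\<^sup>2 + s * b) *
       qb (L + s * even_ceil b + t * b) (m - b) * qb (L - s * even_ceil b - t * b) (m + b)))"
    unfolding bosonic_def sum_distrib_left by (rule sum.swap)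
  also have "\<dots> = (\<Sum>b\<in>I. alt b * q powi ((s + (t + 1) + 1) * b\<^sup>2 + s * b) *
      (qb (L + ?x b + M + b) (M - b) * qb (L - ?x b + M - b) (M + b)))"
  proof (rule sum.cong)
    fix b
    have "(\<Sum>m=0..M. q powi m\<^sup>2 * qb (2 * L + M - m) (M - m) *
        (alt b * q powi ((s + t + 1) * b\<^sup>2 + s * b) *
         qb (L + s * even_ceil b + t * b) (m - b) * qb (L - s * even_ceil b - t * b) (m + b))) =
      (\<Sum>m=0..M. alt b * q powi ((s + (t + 1) + 1) * b\<^sup>2 + s * b) *
        (q powi ((m - b) * (m + b)) * qb (L + ?x b + (L - ?x b) + M - m) (M - m) *
         qb (L + ?x b) (m - b) * qb (L - ?x b) (m + b)))"
    proof (rule sum.cong)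
      fix m
      have "q powi m\<^sup>2 * q powi ((s + t + 1) * b\<^sup>2 + s * b) =
          q powi ((s + (t + 1) + 1) * b\<^sup>2 + s * b) * q powi ((m - b) * (m + b))"
        unfolding qpow_add[symmetric] by (simp add: algebra_simps power2_eq_square)
      moreover have "L + s * even_ceil b + t * b = L + ?x b" "L - s * even_ceil b - t * b = L - ?x b"
        "2 * L + M - m = L + ?x b + (L - ?x b) + M - m"
        by simp_all
      ultimately show "q powi m\<^sup>2 * qb (2 * L + M - m) (M - m) *
          (alt b * q powi ((s + t + 1) * b\<^sup>2 + s * b) *
           qb (L + s * even_ceil b + t * b) (m - b) * qb (L - s * even_ceil b - t * b) (m + b)) =
        alt b * q powi ((s + (t + 1) + 1) * b\<^sup>2 + s * b) *
          (q powi ((m - b) * (m + b)) * qb (L + ?x b + (L - ?x b) + M - m) (M - m) *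
           qb (L + ?x b) (m - b) * qb (L - ?x b) (m + b))"
        by (simp only:) (rule product_rearrange)
    qed simp
    also have "\<dots> = alt b * q powi ((s + (t + 1) + 1) * b\<^sup>2 + s * b) *
        (qb (L + ?x b + M + b) (M - b) * qb (L - ?x b + M - b) (M + b))"
      unfolding sum_distrib_left[symmetric]
      by (subst q_saalschuetz)
        (use assms shift_nonneg[of s t b] shift_nonpos[of s t b] in \<open>auto simp: not_le\<close>)
    finally show "(\<Sum>m=0..M. q powi m\<^sup>2 * qb (2 * L + M - m) (M - m) *
        (alt b * q powi ((s + t + 1) * b\<^sup>2 + s * b) *
         qb (L + s * even_ceil b + t * b) (m - b) * qb (L - s * even_ceil b - t * b) (m + b))) =
      alt b * q powi ((s + (t + 1) + 1) * b\<^sup>2 + s * b) *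
        (qb (L + ?x b + M + b) (M - b) * qb (L - ?x b + M - b) (M + b))" .
  qed simp
  also have "\<dots> = bosonic I s (t + 1) (L + M) M"
    unfolding bosonic_def by (rule sum.cong) (simp_all add: algebra_simps)
  finally show ?thesis .
qed

text \<open>Here m^2 + m = (m - b)(m + b + 1) + b^2 + b, so the shifts are \<open>b\<close> and
  \<open>b + 1\<close>. The upper entries of \<open>bosonic_in\<close> add up to
  \<open>2 * L\<close>, and their correction \<open>even_ceil b - b\<close> together with the shift
  turns \<open>s * even_ceil b\<close> into \<open>(s + 1) * even_ceil b\<close>.\<close>

lemma bosonic_step_shifted:
  assumes "1 \<le> L" "0 \<le> M" "0 \<le> s" "finite I" "{-M-2..M+2} \<subseteq> I"
  shows "(\<Sum>m=0..M. q powi (m\<^sup>2 + m) * qb (2 * L + M - m) (M - m) * bosonic I s 0 (L - 1) m) =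
    bosonic I (s + 1) 0 (L + M) M"
proof -
  let ?w = "\<lambda>b. even_ceil b - b"
  let ?A = "\<lambda>b. L - 1 + s * even_ceil b + ?w b" and ?B = "\<lambda>b. L - 1 + 2 - s * even_ceil b - ?w b"
  have "(\<Sum>m=0..M. q powi (m\<^sup>2 + m) * qb (2 * L + M - m) (M - m) * bosonic I s 0 (L - 1) m) =
    (\<Sum>m=0..M. q powi (m\<^sup>2 + m) * qb (2 * L + M - m) (M - m) * bosonic_in I s (L - 1) m)"
    by (rule sum.cong, simp, subst bosonic_in_eq) (use assms in auto)
  also have "\<dots> = (\<Sum>b\<in>I. \<Sum>m=0..M. q powi (m\<^sup>2 + m) * qb (2 * L + M - m) (M - m) *
      (alt b * q powi ((s + 1) * b\<^sup>2 + s * b) * qb (?A b) (m - b) * qb (?B b) (m + b + 1)))"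
    unfolding bosonic_in_def sum_distrib_left by (rule sum.swap)
  also have "\<dots> = (\<Sum>b\<in>I. alt b * q powi ((s + 1 + 1) * b\<^sup>2 + (s + 1) * b) *
      (qb (?A b + M + (b + 1)) (M - b) * qb (?B b + M - b) (M + (b + 1))))"
  proof (rule sum.cong)
    fix b
    have "(\<Sum>m=0..M. q powi (m\<^sup>2 + m) * qb (2 * L + M - m) (M - m) *
        (alt b * q powi ((s + 1) * b\<^sup>2 + s * b) * qb (?A b) (m - b) * qb (?B b) (m + b + 1))) =
      (\<Sum>m=0..M. alt b * q powi ((s + 1 + 1) * b\<^sup>2 + (s + 1) * b) *
        (q powi ((m - b) * (m + (b + 1))) * qb (?A b + ?B b + M - m) (M - m) *
         qb (?A b) (m - b) * qb (?B b) (m + (b + 1))))"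
    proof (rule sum.cong)
      fix m
      have "q powi (m\<^sup>2 + m) * q powi ((s + 1) * b\<^sup>2 + s * b) =
          q powi ((s + 1 + 1) * b\<^sup>2 + (s + 1) * b) * q powi ((m - b) * (m + (b + 1)))"
        unfolding qpow_add[symmetric] by (simp add: algebra_simps power2_eq_square)
      moreover have "2 * L + M - m = ?A b + ?B b + M - m" "m + b + 1 = m + (b + 1)"
        by simp_all
      ultimately show "q powi (m\<^sup>2 + m) * qb (2 * L + M - m) (M - m) *
          (alt b * q powi ((s + 1) * b\<^sup>2 + s * b) * qb (?A b) (m - b) * qb (?B b) (m + b + 1)) =
        alt b * q powi ((s + 1 + 1) * b\<^sup>2 + (s + 1) * b) *
          (q powi ((m - b) * (m + (b + 1))) * qb (?A b + ?B b + M - m) (M - m) *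
           qb (?A b) (m - b) * qb (?B b) (m + (b + 1)))"
        by (simp only:) (rule product_rearrange)
    qed simp
    also have "\<dots> = alt b * q powi ((s + 1 + 1) * b\<^sup>2 + (s + 1) * b) *
        (qb (?A b + M + (b + 1)) (M - b) * qb (?B b + M - b) (M + (b + 1)))"
      unfolding sum_distrib_left[symmetric]
      by (subst q_saalschuetz)
        (use assms shift_nonneg[of s 0 b] shift_nonpos[of s 0 b] in \<open>auto simp: even_ceil_def\<close>)
    finally show "(\<Sum>m=0..M. q powi (m\<^sup>2 + m) * qb (2 * L + M - m) (M - m) *
        (alt b * q powi ((s + 1) * b\<^sup>2 + s * b) * qb (?A b) (m - b) * qb (?B b) (m + b + 1))) =
      alt b * q powi ((s + 1 + 1) * b\<^sup>2 + (s + 1) * b) *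
        (qb (?A b + M + (b + 1)) (M - b) * qb (?B b + M - b) (M + (b + 1)))" .
  qed simp
  also have "\<dots> = bosonic_out I (s + 1) (L + M) M"
    unfolding bosonic_out_def by (rule sum.cong) (simp_all add: algebra_simps)
  also have "\<dots> = bosonic I (s + 1) 0 (L + M) M"
    by (rule bosonic_out_eq) (use assms in auto)
  finally show ?thesis .
qed

text \<open>No linking factor remains, so \<open>q_vandermonde_centred\<close> replaces
  q-Saalschuetz; \<open>n \<le> B\<close> lets the range cover all nonzero terms.\<close>

lemma bosonic_final:
  assumes "0 \<le> n" "n \<le> B" "0 \<le> s" "0 \<le> t"
  shows "(\<Sum>m=0..B. q powi m\<^sup>2 * bosonic I s t n m) =
    (\<Sum>b\<in>I. alt b * q powi ((s + t + 2) * b\<^sup>2 + s * b) * qb (2 * n) (n - s * even_ceil b - (t + 2) * b))"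
proof -
  let ?x = "\<lambda>b. s * even_ceil b + t * b"
  have "(\<Sum>m=0..B. q powi m\<^sup>2 * bosonic I s t n m) =
    (\<Sum>b\<in>I. \<Sum>m=0..B. q powi m\<^sup>2 * (alt b * q powi ((s + t + 1) * b\<^sup>2 + s * b) *
       qb (n + s * even_ceil b + t * b) (m - b) * qb (n - s * even_ceil b - t * b) (m + b)))"
    unfolding bosonic_def sum_distrib_left by (rule sum.swap)
  also have "\<dots> = (\<Sum>b\<in>I. alt b * q powi ((s + t + 2) * b\<^sup>2 + s * b) *
      qb (n + ?x b + (n - ?x b)) (n - ?x b - b - b))"
  proof (rule sum.cong)
    fix b
    have "(\<Sum>m=0..B. q powi m\<^sup>2 * (alt b * q powi ((s + t + 1) * b\<^sup>2 + s * b) *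
         qb (n + s * even_ceil b + t * b) (m - b) * qb (n - s * even_ceil b - t * b) (m + b))) =
      (\<Sum>m=0..B. alt b * q powi ((s + t + 2) * b\<^sup>2 + s * b) *
        (q powi ((m - b) * (m + b)) * qb (n + ?x b) (m - b) * qb (n - ?x b) (m + b)))"
    proof (rule sum.cong)
      fix m
      have "q powi m\<^sup>2 * q powi ((s + t + 1) * b\<^sup>2 + s * b) =
          q powi ((s + t + 2) * b\<^sup>2 + s * b) * q powi ((m - b) * (m + b))"
        unfolding qpow_add[symmetric] by (simp add: algebra_simps power2_eq_square)
      moreover have "n + s * even_ceil b + t * b = n + ?x b" "n - s * even_ceil b - t * b = n - ?x b"
        by simp_all
      ultimately show "q powi m\<^sup>2 * (alt b * q powi ((s + t + 1) * b\<^sup>2 + s * b) *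
           qb (n + s * even_ceil b + t * b) (m - b) * qb (n - s * even_ceil b - t * b) (m + b)) =
        alt b * q powi ((s + t + 2) * b\<^sup>2 + s * b) *
          (q powi ((m - b) * (m + b)) * qb (n + ?x b) (m - b) * qb (n - ?x b) (m + b))"
        by (simp only:) (rule product_rearrange_final)
    qed simp
    also have "\<dots> = alt b * q powi ((s + t + 2) * b\<^sup>2 + s * b) *
        qb (n + ?x b + (n - ?x b)) (n - ?x b - b - b)"
      unfolding sum_distrib_left[symmetric]
      by (subst q_vandermonde_centred)
        (use assms shift_nonneg[of s t b] shift_nonpos[of s t b] in \<open>auto simp: not_le\<close>)
    finally show "(\<Sum>m=0..B. q powi m\<^sup>2 * (alt b * q powi ((s + t + 1) * b\<^sup>2 + s * b) *
         qb (n + s * even_ceil b + t * b) (m - b) * qb (n - s * even_ceil b - t * b) (m + b))) =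
      alt b * q powi ((s + t + 2) * b\<^sup>2 + s * b) * qb (n + ?x b + (n - ?x b)) (n - ?x b - b - b)" .
  qed simp
  also have "\<dots> = (\<Sum>b\<in>I. alt b * q powi ((s + t + 2) * b\<^sup>2 + s * b) *
      qb (2 * n) (n - s * even_ceil b - (t + 2) * b))"
    by (rule sum.cong) (simp_all add: algebra_simps)
  finally show ?thesis .
qed

text \<open>The variant for a first variable with linear weight, again by way of
  \<open>bosonic_in\<close>.\<close>

lemma bosonic_final_shifted:
  assumes "1 \<le> n" "n \<le> B" "0 \<le> s" "finite I" "{-B-2..B+2} \<subseteq> I"
  shows "(\<Sum>m=0..B. q powi (m\<^sup>2 + m) * bosonic I s 0 (n - 1) m) =
    (\<Sum>b\<in>I. alt b * q powi ((s + 2) * b\<^sup>2 + (s + 1) * b) * qb (2 * n) (n - (s + 1) * even_ceil b - b))"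
proof -
  let ?w = "\<lambda>b. even_ceil b - b"
  let ?A = "\<lambda>b. n - 1 + s * even_ceil b + ?w b" and ?B = "\<lambda>b. n - 1 + 2 - s * even_ceil b - ?w b"
  have "(\<Sum>m=0..B. q powi (m\<^sup>2 + m) * bosonic I s 0 (n - 1) m) =
    (\<Sum>m=0..B. q powi (m\<^sup>2 + m) * bosonic_in I s (n - 1) m)"
    by (rule sum.cong, simp, subst bosonic_in_eq) (use assms in auto)
  also have "\<dots> = (\<Sum>b\<in>I. \<Sum>m=0..B. q powi (m\<^sup>2 + m) *
      (alt b * q powi ((s + 1) * b\<^sup>2 + s * b) * qb (?A b) (m - b) * qb (?B b) (m + b + 1)))"
    unfolding bosonic_in_def sum_distrib_left by (rule sum.swap)
  also have "\<dots> = (\<Sum>b\<in>I. alt b * q powi ((s + 2) * b\<^sup>2 + (s + 1) * b) *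
      qb (?A b + ?B b) (?B b - b - (b + 1)))"
  proof (rule sum.cong)
    fix b
    have "(\<Sum>m=0..B. q powi (m\<^sup>2 + m) *
        (alt b * q powi ((s + 1) * b\<^sup>2 + s * b) * qb (?A b) (m - b) * qb (?B b) (m + b + 1))) =
      (\<Sum>m=0..B. alt b * q powi ((s + 2) * b\<^sup>2 + (s + 1) * b) *
        (q powi ((m - b) * (m + (b + 1))) * qb (?A b) (m - b) * qb (?B b) (m + (b + 1))))"
    proof (rule sum.cong)
      fix m
      have "q powi (m\<^sup>2 + m) * q powi ((s + 1) * b\<^sup>2 + s * b) =
          q powi ((s + 2) * b\<^sup>2 + (s + 1) * b) * q powi ((m - b) * (m + (b + 1)))"
        unfolding qpow_add[symmetric] by (simp add: algebra_simps power2_eq_square)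
      moreover have "m + b + 1 = m + (b + 1)"
        by simp
      ultimately show "q powi (m\<^sup>2 + m) *
          (alt b * q powi ((s + 1) * b\<^sup>2 + s * b) * qb (?A b) (m - b) * qb (?B b) (m + b + 1)) =
        alt b * q powi ((s + 2) * b\<^sup>2 + (s + 1) * b) *
          (q powi ((m - b) * (m + (b + 1))) * qb (?A b) (m - b) * qb (?B b) (m + (b + 1)))"
        by (simp only:) (rule product_rearrange_final)
    qed simp
    also have "\<dots> = alt b * q powi ((s + 2) * b\<^sup>2 + (s + 1) * b) *
        qb (?A b + ?B b) (?B b - b - (b + 1))"
      unfolding sum_distrib_left[symmetric]
      by (subst q_vandermonde_centred)
        (use assms shift_nonneg[of s 0 b] shift_nonpos[of s 0 b] in \<open>auto simp: even_ceil_def\<close>)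
    finally show "(\<Sum>m=0..B. q powi (m\<^sup>2 + m) *
        (alt b * q powi ((s + 1) * b\<^sup>2 + s * b) * qb (?A b) (m - b) * qb (?B b) (m + b + 1))) =
      alt b * q powi ((s + 2) * b\<^sup>2 + (s + 1) * b) * qb (?A b + ?B b) (?B b - b - (b + 1))" .
  qed simp
  also have "\<dots> = (\<Sum>b\<in>I. alt b * q powi ((s + 2) * b\<^sup>2 + (s + 1) * b) *
      qb (2 * n) (n - (s + 1) * even_ceil b - b))"
    by (rule sum.cong) (simp_all add: algebra_simps)
  finally show ?thesis .
qed

text \<open>The lower entries add up to \<open>2 * M\<close>, the upper ones to
  \<open>2 * N\<close>, so in each term some lower entry is too large.\<close>

lemma bosonic_eq_0:
  assumes "N < M"
  shows "bosonic I s t N M = 0"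
  unfolding bosonic_def
proof (rule sum.neutral, rule ballI)
  fix b
  have "qb (N + s * even_ceil b + t * b) (M - b) = 0 \<or> qb (N - s * even_ceil b - t * b) (M + b) = 0"
    using assms by (cases "M - b \<le> N + s * even_ceil b + t * b") (auto intro!: qb_eq_0)
  then show "alt b * q powi ((s + t + 1) * b\<^sup>2 + s * b) * qb (N + s * even_ceil b + t * b) (M - b) *
      qb (N - s * even_ceil b - t * b) (M + b) = 0"
    by auto
qed

text \<open>The shift \<open>s * even_ceil b\<close> has the sign of \<open>b\<close>, so for
  \<open>b \<noteq> 0\<close> one of the lower entries exceeds its upper entry.\<close>

lemma bosonic_diagonal:
  assumes "0 \<le> M" "0 \<le> s" "finite I" "0 \<in> I"
  shows "bosonic I s 0 M M = 1"
proof -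
  have "bosonic I s 0 M M = (\<Sum>b\<in>I. if b = 0 then 1 else 0)"
    unfolding bosonic_def
  proof (rule sum.cong)
    fix b :: int
    consider "b = 0" | "b < 0" | "0 < b" by linarith
    then show "alt b * q powi ((s + 0 + 1) * b\<^sup>2 + s * b) * qb (M + s * even_ceil b + 0 * b) (M - b) *
        qb (M - s * even_ceil b - 0 * b) (M + b) = (if b = 0 then 1 else 0)"
    proof cases
      case 1
      with assms show ?thesis by (simp add: even_ceil_def alt_def)
    next
      case 2
      with assms(2) shift_nonpos[of s 0 b] show ?thesis by (simp add: qb_eq_0)
    next
      case 3
      with assms(2) shift_nonneg[of s 0 b] show ?thesis by (simp add: qb_eq_0)
    qed
  qed simp
  with assms show ?thesis by simp
qed

section \<open>The fermionic sum, one summation variable at a time\<close>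

abbreviation qb' :: "int \<Rightarrow> int \<Rightarrow> 'a" where
  "qb' \<equiv> q_binomial' q"

text \<open>
  The inner part of the multisum after \<open>n\<^sub>1, \<dots>, n\<^sub>j\<close> have been fixed, where \<open>M = n\<^sub>j\<close> and
  \<open>L = n - n\<^sub>1 - \<dots> - n\<^sub>j - \<alpha>\<^sub>i\<^sub>j\<close>. There remain \<open>t\<close> variables with weight \<open>q powi m\<^sup>2\<close>,
  then \<open>s\<close> variables with weight \<open>q powi (m\<^sup>2 + m)\<close>.
\<close>

fun tail :: "nat \<Rightarrow> nat \<Rightarrow> int \<Rightarrow> int \<Rightarrow> 'a" where
  "tail 0 0 L M = q_binomial' (q\<^sup>2) (L + M) M"
| "tail 0 (Suc s) L M =
    (\<Sum>m=0..M. q powi (m\<^sup>2 + m) * qb' (2 * L + M - m) (M - m) * tail 0 s (L - m - 1) m)"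
| "tail (Suc t) s L M =
    (\<Sum>m=0..M. q powi m\<^sup>2 * qb' (2 * L + M - m) (M - m) * tail t s (L - m) m)"

lemma qb'_nonneg: "0 \<le> a \<Longrightarrow> qb' a b = qb a b"
  by (simp add: q_binomial'_def)

lemma qb'_double: "L < 0 \<Longrightarrow> 0 \<le> M \<Longrightarrow> qb' (2 * L + M) M = (if M = 0 then 1 else 0)"
  by (auto simp: q_binomial'_def qb_eq_0)

text \<open>Here the convention for primed coefficients matters. A negative \<open>L\<close> stays
  negative further in, so only the zero tuple survives, with all its coefficients equal to
  1.\<close>

lemma tail_negative:
  assumes "L < 0" "0 \<le> M"
  shows "tail t s L M = (if M = 0 then 1 else 0)"
  using assms
proof (induction t s L M rule: tail.induct)
  case (1 L M)
  then show ?case by (auto simp: q_binomial'_def q_binomial_def)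
next
  case (2 s L M)
  have "tail 0 (Suc s) L M = (\<Sum>m=0..M. if m = 0 then qb' (2 * L + M) M else 0)"
    unfolding tail.simps
  proof (rule sum.cong)
    fix m assume m: "m \<in> {0..M}"
    then have "tail 0 s (L - m - 1) m = (if m = 0 then 1 else 0)"
      using 2 by auto
    then show "q powi (m\<^sup>2 + m) * qb' (2 * L + M - m) (M - m) * tail 0 s (L - m - 1) m =
        (if m = 0 then qb' (2 * L + M) M else 0)"
      by simp
  qed simp
  with 2(2,3) show ?case by (simp add: qb'_double)
next
  case (3 t s L M)
  have "tail (Suc t) s L M = (\<Sum>m=0..M. if m = 0 then qb' (2 * L + M) M else 0)"
    unfolding tail.simps
  proof (rule sum.cong)
    fix m assume m: "m \<in> {0..M}"
    then have "tail t s (L - m) m = (if m = 0 then 1 else 0)"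
      using 3 by auto
    then show "q powi m\<^sup>2 * qb' (2 * L + M - m) (M - m) * tail t s (L - m) m =
        (if m = 0 then qb' (2 * L + M) M else 0)"
      by simp
  qed simp
  with 3(2,3) show ?case by (simp add: qb'_double)
qed

text \<open>Each recursion step of \<open>tail\<close> is one summation step for
  \<open>bosonic\<close>: the inner \<open>L\<close> plus \<open>m\<close> is \<open>L\<close> or
  \<open>L - 1\<close>, independent of \<open>m\<close>.\<close>

lemma tail_eq_bosonic:
  assumes "0 \<le> L" "0 \<le> M" "finite I" "{-M-2..M+2} \<subseteq> I"
  shows "tail t s L M = bosonic I (int s) (int t) (L + M) M"
  using assms(1,2,4)
proof (induction t s L M rule: tail.induct)
  case (1 L M)
  then show ?case using assms(3) by (simp add: q_binomial'_def bosonic_base)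
next
  case (2 s L M)
  show ?case
  proof (cases "L = 0")
    \<comment> \<open>With \<open>L = 0\<close> all inner parameters are negative and
      \<open>bosonic_step_shifted\<close> does not apply; only \<open>m = 0\<close>
      contributes.\<close>
    case True
    have "tail 0 (Suc s) L M = (\<Sum>m=0..M. if m = 0 then 1 else 0)"
      unfolding tail.simps
      by (rule sum.cong) (use 2(2,3) True in \<open>auto simp: tail_negative qb'_nonneg\<close>)
    also have "\<dots> = bosonic I (int (Suc s)) 0 M M"
      by (subst bosonic_diagonal) (use 2 assms(3) in auto)
    finally show ?thesis using True by simp
  next
    case False
    have "tail 0 (Suc s) L M =
      (\<Sum>m=0..M. q powi (m\<^sup>2 + m) * qb (2 * L + M - m) (M - m) * bosonic I (int s) 0 (L - 1) m)"
      unfolding tail.simps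
    proof (rule sum.cong)
      fix m assume m: "m \<in> {0..M}"
      have "tail 0 s (L - m - 1) m = bosonic I (int s) 0 (L - 1) m"
      proof (cases "m < L")
        case True
        have "{-m-2..m+2} \<subseteq> {-M-2..M+2}" using m by auto
        with 2(4) have "{-m-2..m+2} \<subseteq> I" by (rule order_trans[rotated])
        then have "tail 0 s (L - m - 1) m = bosonic I (int s) (int 0) (L - m - 1 + m) m"
          by (intro 2(1)) (use m True in auto)
        then show ?thesis by simp
      next
        case False
        with m \<open>L \<noteq> 0\<close> 2(2) show ?thesis by (auto simp: tail_negative bosonic_eq_0)
      qed
      with m 2(2) show "q powi (m\<^sup>2 + m) * qb' (2 * L + M - m) (M - m) * tail 0 s (L - m - 1) m =
          q powi (m\<^sup>2 + m) * qb (2 * L + M - m) (M - m) * bosonic I (int s) 0 (L - 1) m"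
        by (auto simp: qb'_nonneg)
    qed simp
    also have "\<dots> = bosonic I (int s + 1) 0 (L + M) M"
      by (rule bosonic_step_shifted) (use 2 False assms(3) in auto)
    finally show ?thesis by (simp add: add.commute)
  qed
next
  case (3 t s L M)
  have "tail (Suc t) s L M =
    (\<Sum>m=0..M. q powi m\<^sup>2 * qb (2 * L + M - m) (M - m) * bosonic I (int s) (int t) L m)"
    unfolding tail.simps
  proof (rule sum.cong)
    fix m assume m: "m \<in> {0..M}"
    have "tail t s (L - m) m = bosonic I (int s) (int t) L m"
    proof (cases "m \<le> L")
      case True
      have "{-m-2..m+2} \<subseteq> {-M-2..M+2}" using m by auto
      with 3(4) have "{-m-2..m+2} \<subseteq> I" by (rule order_trans[rotated])
      then have "tail t s (L - m) m = bosonic I (int s) (int t) (L - m + m) m"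
        by (intro 3(1)) (use m True in auto)
      then show ?thesis by simp
    next
      case False
      with m 3(2) show ?thesis by (auto simp: tail_negative bosonic_eq_0)
    qed
    with m 3(2) show "q powi m\<^sup>2 * qb' (2 * L + M - m) (M - m) * tail t s (L - m) m =
        q powi m\<^sup>2 * qb (2 * L + M - m) (M - m) * bosonic I (int s) (int t) L m"
      by (auto simp: qb'_nonneg)
  qed simp
  also have "\<dots> = bosonic I (int s) (int t + 1) (L + M) M"
    by (rule bosonic_step) (use 3 in auto)
  finally show ?case by (simp add: add.commute)
qed

lemma tail_total_eq_bosonic:
  assumes "0 \<le> n" "0 \<le> m" "finite I" "{-m-2..m+2} \<subseteq> I"
  shows "tail t s (n - m) m = bosonic I (int s) (int t) n m"
  using tail_eq_bosonic[of "n - m" m I t s] tail_negative[of "n - m" m t s] bosonic_eq_0[of n m] assms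
  by (cases "m \<le> n") auto

lemma sum_tail:
  assumes "0 \<le> n" "n \<le> B" "finite I" "{-B-2..B+2} \<subseteq> I"
  shows "(\<Sum>m=0..B. q powi m\<^sup>2 * tail t s (n - m) m) =
    (\<Sum>b\<in>I. alt b * q powi ((int s + int t + 2) * b\<^sup>2 + int s * b) *
      qb (2 * n) (n - int s * even_ceil b - (int t + 2) * b))"
proof -
  have "(\<Sum>m=0..B. q powi m\<^sup>2 * tail t s (n - m) m) =
    (\<Sum>m=0..B. q powi m\<^sup>2 * bosonic I (int s) (int t) n m)"
    by (rule sum.cong, simp, subst tail_total_eq_bosonic[of _ _ I]) (use assms in auto)
  also have "\<dots> = (\<Sum>b\<in>I. alt b * q powi ((int s + int t + 2) * b\<^sup>2 + int s * b) *
      qb (2 * n) (n - int s * even_ceil b - (int t + 2) * b))"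
    by (rule bosonic_final) (use assms in auto)
  finally show ?thesis .
qed

text \<open>\<open>bosonic_final_shifted\<close> requires \<open>1 \<le> n\<close>; for
  \<open>n = 0\<close> both sides reduce to their term at index 0, which is 1.\<close>

lemma sum_tail_shifted:
  assumes "0 \<le> n" "n \<le> B" "finite I" "{-B-2..B+2} \<subseteq> I"
  shows "(\<Sum>m=0..B. q powi (m\<^sup>2 + m) * tail 0 s (n - 1 - m) m) =
    (\<Sum>b\<in>I. alt b * q powi ((int s + 2) * b\<^sup>2 + (int s + 1) * b) *
      qb (2 * n) (n - (int s + 1) * even_ceil b - b))"
proof (cases "n = 0")
  case True
  have "(\<Sum>m=0..B. q powi (m\<^sup>2 + m) * tail 0 s (n - 1 - m) m) = (\<Sum>m=0..B. if m = 0 then 1 else 0)"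
    by (rule sum.cong) (use True in \<open>auto simp: tail_negative\<close>)
  also have "\<dots> = (\<Sum>b\<in>I. if b = 0 then 1 else 0)"
    using assms True by auto
  also have "\<dots> = (\<Sum>b\<in>I. alt b * q powi ((int s + 2) * b\<^sup>2 + (int s + 1) * b) *
      qb (2 * n) (n - (int s + 1) * even_ceil b - b))"
  proof (rule sum.cong)
    fix b :: int
    consider "b = 0" | "b < 0" | "0 < b" by linarith
    then show "(if b = 0 then 1 else 0) = alt b * q powi ((int s + 2) * b\<^sup>2 + (int s + 1) * b) *
      qb (2 * n) (n - (int s + 1) * even_ceil b - b)"
    proof cases
      case 1
      with True show ?thesis by (simp add: even_ceil_def alt_def)
    next
      case 2
      with shift_nonpos[of "int s + 1" 0 b] True have "2 * n < n - (int s + 1) * even_ceil b - b"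
        by linarith
      then have *: "qb (2 * n) (n - (int s + 1) * even_ceil b - b) = 0"
        by (intro qb_eq_0 disjI2)
      show ?thesis unfolding * using 2 by simp
    next
      case 3
      with shift_nonneg[of "int s + 1" 0 b] True have "n - (int s + 1) * even_ceil b - b < 0"
        by linarith
      then have *: "qb (2 * n) (n - (int s + 1) * even_ceil b - b) = 0"
        by (intro qb_eq_0 disjI1)
      show ?thesis unfolding * using 3 by simp
    qed
  qed simp
  finally show ?thesis .
next
  case False
  have "(\<Sum>m=0..B. q powi (m\<^sup>2 + m) * tail 0 s (n - 1 - m) m) =
    (\<Sum>m=0..B. q powi (m\<^sup>2 + m) * bosonic I (int s) 0 (n - 1) m)"
    by (rule sum.cong, simp, subst tail_total_eq_bosonic[of _ _ I]) (use assms False in auto)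
  also have "\<dots> = (\<Sum>b\<in>I. alt b * q powi ((int s + 2) * b\<^sup>2 + (int s + 1) * b) *
      qb (2 * n) (n - (int s + 1) * even_ceil b - b))"
    by (rule bosonic_final_shifted) (use assms False in auto)
  finally show ?thesis .
qed

end

section \<open>Sums over decreasing tuples with bounded first entry\<close>

definition bounded_tuples :: "int \<Rightarrow> int \<Rightarrow> (int \<Rightarrow> int) set" where
  "bounded_tuples B l = {m \<in> decreasing_tuples l. m 1 \<le> B}"

lemma bounded_tuples_iff:
  assumes "1 \<le> l"
  shows "m \<in> bounded_tuples B l \<longleftrightarrow> m 1 \<le> B \<and> (\<forall>j. j < 1 \<or> l < j \<longrightarrow> m j = undefined) \<and>
    (\<forall>j. 1 \<le> j \<and> j \<le> l \<longrightarrow> 0 \<le> m j) \<and> (\<forall>j j'. 1 \<le> j \<and> j \<le> j' \<and> j' \<le> l \<longrightarrow> m j' \<le> m j)"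
  using assms
  by (auto simp: bounded_tuples_def decreasing_tuples_def PiE_iff extensional_def monotone_on_def not_le)

lemma finite_bounded_tuples:
  assumes "1 \<le> l"
  shows "finite (bounded_tuples B l)"
proof (rule finite_subset)
  show "bounded_tuples B l \<subseteq> {1..l} \<rightarrow>\<^sub>E {0..B}"
  proof
    fix m assume "m \<in> bounded_tuples B l"
    then show "m \<in> {1..l} \<rightarrow>\<^sub>E {0..B}"
      unfolding bounded_tuples_iff[OF assms]
      by (auto simp: PiE_iff extensional_def not_le intro: order_trans[of _ "m 1"])
  qed
qed (intro finite_PiE; simp)

lemma sum_bounded_tuples_1:
  "sum f (bounded_tuples B 1) = (\<Sum>v=0..B. f ((\<lambda>_. undefined)(1 := v)))"
proof (rule sum.reindex_bij_witness[of _ "\<lambda>v. (\<lambda>_. undefined)(1 := v)" "\<lambda>m. m 1"])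
  fix m assume "m \<in> bounded_tuples B 1"
  then show eq: "(\<lambda>_. undefined)(1 := m 1) = m"
    by (auto simp: bounded_tuples_iff fun_eq_iff linorder_neq_iff)
  show "m 1 \<in> {0..B}"
    using \<open>m \<in> bounded_tuples B 1\<close> by (auto simp: bounded_tuples_iff)
  show "f ((\<lambda>_. undefined)(1 := m 1)) = f m"
    by (simp add: eq)
next
  fix v assume "v \<in> {0..B}"
  then show "(\<lambda>_. undefined)(1 := v) \<in> bounded_tuples B 1"
    by (auto simp: bounded_tuples_iff)
qed simp

lemma sum_bounded_tuples_Suc:
  assumes "1 \<le> l"
  shows "sum f (bounded_tuples B (l + 1)) =
    (\<Sum>m\<in>bounded_tuples B l. \<Sum>v=0..m l. f (m(l + 1 := v)))"
proof -
  have l: "1 \<le> l + 1" using assms by simp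
  have "(\<Sum>m\<in>bounded_tuples B l. \<Sum>v=0..m l. f (m(l + 1 := v))) =
    (\<Sum>(m, v)\<in>(SIGMA m:bounded_tuples B l. {0..m l}). f (m(l + 1 := v)))"
    by (rule sum.Sigma) (use finite_bounded_tuples[OF assms] in auto)
  also have "\<dots> = sum f (bounded_tuples B (l + 1))"
  proof (rule sum.reindex_bij_witness[of _ "\<lambda>m. (m(l + 1 := undefined), m (l + 1))"
        "\<lambda>(m, v). m(l + 1 := v)"])
    fix p assume p: "p \<in> (SIGMA m:bounded_tuples B l. {0..m l})"
    obtain m v where mv: "p = (m, v)" by (cases p)
    with p have m: "m \<in> bounded_tuples B l" and v: "0 \<le> v" "v \<le> m l" by auto
    \<comment> \<open>Resetting the new entry to \<open>undefined\<close> therefore restores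
      \<open>m\<close> exactly.\<close>
    have "m (l + 1) = undefined"
      using m by (simp add: bounded_tuples_iff[OF assms])
    then show "(((case p of (m, v) \<Rightarrow> m(l + 1 := v))(l + 1 := undefined)),
        (case p of (m, v) \<Rightarrow> m(l + 1 := v)) (l + 1)) = p"
      by (auto simp: mv fun_upd_idem)
    have "v \<le> m j" if "1 \<le> j" "j \<le> l" for j
      using m v that unfolding bounded_tuples_iff[OF assms] by (meson order.refl order.trans)
    then show "(case p of (m, v) \<Rightarrow> m(l + 1 := v)) \<in> bounded_tuples B (l + 1)"
      using m v assms unfolding bounded_tuples_iff[OF assms] bounded_tuples_iff[OF l] mv by auto
  next
    fix m assume m: "m \<in> bounded_tuples B (l + 1)"
    show "(m(l + 1 := undefined), m (l + 1)) \<in> (SIGMA m:bounded_tuples B l. {0..m l})"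
      using m assms unfolding bounded_tuples_iff[OF l]
      by (auto simp: bounded_tuples_iff[OF assms])
  qed auto
  finally show ?thesis ..
qed

lemma sum_int_Suc: "a \<le> j + 1 \<Longrightarrow> (\<Sum>l=a..j+1. f l) = (\<Sum>l=a..j. f l) + f (j + 1)"
  for a j :: int and f :: "int \<Rightarrow> int"
  using atLeastAtMostPlus1_int_conv[of a j] by (simp add: add.commute)

section \<open>Reduction of the multisum to its first variable\<close>

context generic_base
begin

text \<open>The summand after the variables beyond \<open>j\<close> have been summed out into
  \<open>tail\<close>. Of these, \<open>i - 1 - j\<close> (or none) precede index \<open>i\<close>
  and have purely quadratic weight; \<open>min (k - i) (k - 1 - j)\<close> have linear weight
  too.\<close>

definition partial_summand :: "int \<Rightarrow> int \<Rightarrow> int \<Rightarrow> int \<Rightarrow> (int \<Rightarrow> int) \<Rightarrow> 'a" where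
  "partial_summand n k i j m =
    q powi ((\<Sum>l=1..j. (m l)\<^sup>2) + (\<Sum>l=i..j. m l)) *
    tail (nat (i - 1 - j)) (nat (min (k - i) (k - 1 - j))) (n - (\<Sum>l=1..j. m l) - alpha i j) (m j) *
    (\<Prod>l=1..j-1. qb' (2 * n - 2 * (\<Sum>r=1..l-1. m r) - m l - m (l + 1) - 2 * alpha i l) (m l - m (l + 1)))"

text \<open>\<open>alpha i j\<close> grows by one exactly when the next variable has index at least
  \<open>i\<close>; this is the extra -1 in the recursion of \<open>tail\<close>.\<close>

lemma tail_unfold:
  assumes "i \<le> k" "j + 1 \<le> k - 1"
  shows "tail (nat (i - 1 - j)) (nat (min (k - i) (k - 1 - j))) (L - alpha i j) M =
    (\<Sum>v=0..M. q powi (v\<^sup>2 + (if i \<le> j + 1 then v else 0)) * qb' (2 * (L - alpha i j) + M - v) (M - v) *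
      tail (nat (i - 1 - (j + 1))) (nat (min (k - i) (k - 1 - (j + 1)))) (L - v - alpha i (j + 1)) v)"
proof (cases "i \<le> j + 1")
  case True
  then have "nat (i - 1 - j) = 0" "nat (i - 1 - (j + 1)) = 0"
    "nat (min (k - i) (k - 1 - j)) = Suc (nat (min (k - i) (k - 1 - (j + 1))))"
    "alpha i (j + 1) = alpha i j + 1"
    using assms by (auto simp: alpha_def)
  then show ?thesis using True by (simp add: algebra_simps)
next
  case False
  then have "nat (i - 1 - j) = Suc (nat (i - 1 - (j + 1)))"
    "nat (min (k - i) (k - 1 - j)) = nat (min (k - i) (k - 1 - (j + 1)))"
    "alpha i (j + 1) = 0" "alpha i j = 0"
    using assms by (auto simp: alpha_def)
  then show ?thesis using False by simp
qed

lemma partial_summand_step: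
  assumes "1 \<le> j" "j + 1 \<le> k - 1" "i \<le> k"
  shows "partial_summand n k i j m = (\<Sum>v=0..m j. partial_summand n k i (j + 1) (m(j + 1 := v)))"
proof -
  let ?P = "\<lambda>m l. qb' (2 * n - 2 * (\<Sum>r=1..l-1. m r) - m l - m (l + 1) - 2 * alpha i l) (m l - m (l + 1))"
  let ?L = "n - (\<Sum>l=1..j. m l)"
  have old: "(\<Sum>l=a..b. f ((m(j + 1 := v)) l)) = (\<Sum>l=a..b. f (m l))"
    if "b \<le> j" for a b v and f :: "int \<Rightarrow> int"
    by (rule sum.cong) (use that in auto)
  have "partial_summand n k i (j + 1) (m(j + 1 := v)) =
    q powi ((\<Sum>l=1..j. (m l)\<^sup>2) + (\<Sum>l=i..j. m l)) *
    (q powi (v\<^sup>2 + (if i \<le> j + 1 then v else 0)) * qb' (2 * (?L - alpha i j) + m j - v) (m j - v) *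
      tail (nat (i - 1 - (j + 1))) (nat (min (k - i) (k - 1 - (j + 1)))) (?L - v - alpha i (j + 1)) v) *
    (\<Prod>l=1..j-1. ?P m l)" for v
  proof -
    have squares: "(\<Sum>l=1..j+1. ((m(j + 1 := v)) l)\<^sup>2) = (\<Sum>l=1..j. (m l)\<^sup>2) + v\<^sup>2"
      using assms(1) old[of j "\<lambda>x. x\<^sup>2"] by (simp add: sum_int_Suc del: fun_upd_apply) simp
    have all: "(\<Sum>l=1..j+1. (m(j + 1 := v)) l) = (\<Sum>l=1..j. m l) + v"
      using assms(1) old[of j "\<lambda>x. x"] by (simp add: sum_int_Suc del: fun_upd_apply) simp
    have linear: "(\<Sum>l=i..j+1. (m(j + 1 := v)) l) = (\<Sum>l=i..j. m l) + (if i \<le> j + 1 then v else 0)"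
    proof (cases "i \<le> j + 1")
      case True
      then show ?thesis using old[of j "\<lambda>x. x"] by (simp add: sum_int_Suc del: fun_upd_apply) simp
    qed simp
    have "{1..j} = insert j {1..j-1}"
      using assms(1) by auto
    then have "(\<Prod>l=1..j. ?P (m(j + 1 := v)) l) = ?P (m(j + 1 := v)) j * (\<Prod>l=1..j-1. ?P (m(j + 1 := v)) l)"
      by simp
    also have "(\<Prod>l=1..j-1. ?P (m(j + 1 := v)) l) = (\<Prod>l=1..j-1. ?P m l)"
    proof (rule prod.cong)
      fix l assume l: "l \<in> {1..j - 1}"
      then have "(\<Sum>r=1..l-1. (m(j + 1 := v)) r) = (\<Sum>r=1..l-1. m r)"
        by (intro old[of _ "\<lambda>x. x"]) auto
      with l show "?P (m(j + 1 := v)) l = ?P m l" by simp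
    qed simp
    \<comment> \<open>Absorbing \<open>m j\<close> into the full partial sum turns the linking
      coefficient into the form used by \<open>tail\<close>.\<close>
    also have "?P (m(j + 1 := v)) j = qb' (2 * (?L - alpha i j) + m j - v) (m j - v)"
    proof -
      have "(\<Sum>r=1..j-1. (m(j + 1 := v)) r) = (\<Sum>r=1..j-1. m r)"
        by (intro old[of _ "\<lambda>x. x"]) auto
      moreover have "(\<Sum>l=1..j. m l) = (\<Sum>r=1..j-1. m r) + m j"
        using sum_int_Suc[of 1 "j - 1" m] assms(1) by simp
      ultimately show ?thesis by (simp add: algebra_simps)
    qed
    finally have product: "(\<Prod>l=1..j. ?P (m(j + 1 := v)) l) =
      qb' (2 * (?L - alpha i j) + m j - v) (m j - v) * (\<Prod>l=1..j-1. ?P m l)" .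
    have power: "q powi ((\<Sum>l=1..j. (m l)\<^sup>2) + v\<^sup>2 + ((\<Sum>l=i..j. m l) + (if i \<le> j + 1 then v else 0))) =
      q powi ((\<Sum>l=1..j. (m l)\<^sup>2) + (\<Sum>l=i..j. m l)) * q powi (v\<^sup>2 + (if i \<le> j + 1 then v else 0))"
      unfolding qpow_add[symmetric] by (simp only: add_ac)
    have "n - ((\<Sum>l=1..j. m l) + v) - alpha i (j + 1) = ?L - v - alpha i (j + 1)"
      by simp
    then show ?thesis
      unfolding partial_summand_def squares all linear power add_diff_cancel_right' product fun_upd_same
      by (simp only: mult_ac)
  qed
  then have "(\<Sum>v=0..m j. partial_summand n k i (j + 1) (m(j + 1 := v))) =
    q powi ((\<Sum>l=1..j. (m l)\<^sup>2) + (\<Sum>l=i..j. m l)) *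
    tail (nat (i - 1 - j)) (nat (min (k - i) (k - 1 - j))) (?L - alpha i j) (m j) *
    (\<Prod>l=1..j-1. ?P m l)"
    unfolding tail_unfold[OF assms(3,2)] by (simp only: sum_distrib_left sum_distrib_right)
  then show ?thesis
    unfolding partial_summand_def ..
qed

lemma sum_partial_summand:
  assumes "i \<le> k" "1 \<le> j" "j \<le> k - 1"
  shows "(\<Sum>m\<in>bounded_tuples B j. partial_summand n k i j m) =
    (\<Sum>v=0..B. partial_summand n k i 1 ((\<lambda>_. undefined)(1 := v)))"
  using assms(2,3)
proof (induction j rule: int_ge_induct)
  case base
  show ?case by (rule sum_bounded_tuples_1)
next
  case (step j)
  then show ?case
    using partial_summand_step[of j k i n] assms(1) by (simp add: sum_bounded_tuples_Suc)
qed

text \<open>For \<open>i = 1\<close> the first variable carries linear weight and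
  \<open>alpha 1 1 = 1\<close>; for \<open>i > 1\<close> its weight is quadratic and
  \<open>alpha i 1 = 0\<close>.\<close>

lemma sum_partial_summand_1:
  assumes "0 \<le> n" "n \<le> B" "2 \<le> k" "1 \<le> i" "i \<le> k" "finite I" "{-B-2..B+2} \<subseteq> I"
  shows "(\<Sum>v=0..B. partial_summand n k i 1 ((\<lambda>_. undefined)(1 := v))) =
    (\<Sum>b\<in>I. alt b * q powi (k * b\<^sup>2 + (k - i) * b) * qb (2 * n) (n - (k - i) * even_ceil b - i * b))"
proof (cases "i = 1")
  case True
  have "(\<Sum>v=0..B. partial_summand n k i 1 ((\<lambda>_. undefined)(1 := v))) =
    (\<Sum>v=0..B. q powi (v\<^sup>2 + v) * tail 0 (nat (k - 2)) (n - 1 - v) v)"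
    by (rule sum.cong) (use True assms in \<open>simp_all add: partial_summand_def alpha_def algebra_simps\<close>)
  then show ?thesis
    using sum_tail_shifted[OF assms(1,2,6,7), of "nat (k - 2)"] True assms(3) by simp
next
  case False
  have "(\<Sum>v=0..B. partial_summand n k i 1 ((\<lambda>_. undefined)(1 := v))) =
    (\<Sum>v=0..B. q powi v\<^sup>2 * tail (nat (i - 2)) (nat (k - i)) (n - v) v)"
    by (rule sum.cong) (use False assms in \<open>simp_all add: partial_summand_def alpha_def algebra_simps\<close>)
  then show ?thesis
    using sum_tail[OF assms(1,2,6,7), of "nat (i - 2)" "nat (k - i)"] False assms(4,5) by simp
qed

section \<open>Matching the two sides of the identity\<close>

lemma partial_summand_last:
  assumes "2 \<le> k" "i \<le> k"
  shows "partial_summand n k i (k - 1) m =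
    q powi ((\<Sum>j=1..k-1. (m j)\<^sup>2) + (\<Sum>j=i..k-1. m j)) *
    q_binomial' (q\<^sup>2) (n - (\<Sum>j=1..k-2. m j) - k + i) (m (k - 1)) *
    (\<Prod>j=1..k-2. qb' (2 * n - 2 * (\<Sum>l=1..j-1. m l) - m j - m (j + 1) - 2 * alpha i j) (m j - m (j + 1)))"
proof -
  have "(\<Sum>l=1..k-1. m l) = (\<Sum>l=1..k-2. m l) + m (k - 1)"
    using sum_int_Suc[of 1 "k - 2" m] assms(1) by simp
  moreover have "k - 1 - 1 = k - 2" by simp
  ultimately show ?thesis
    using assms by (simp add: partial_summand_def alpha_def algebra_simps)
qed

text \<open>Both lower entries are \<open>n - k * r + (k - i) * (r - even_ceil r)\<close>.\<close>

lemma right_summand: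
  "(-1) powi r * q powi (r * (k * r + k - i)) *
     qb (2 * n) (n - k * r + (k - i) * (((-1) ^ nat \<bar>r\<bar> - 1) div 2)) =
   alt r * q powi (k * r\<^sup>2 + (k - i) * r) * qb (2 * n) (n - (k - i) * even_ceil r - i * r)"
proof -
  have "(-1) powi r = alt r"
    by (simp add: alt_def power_int_minus_left)
  moreover have "r * (k * r + k - i) = k * r\<^sup>2 + (k - i) * r"
    by (simp add: algebra_simps power2_eq_square)
  moreover have "n - k * r + (k - i) * (((-1) ^ nat \<bar>r\<bar> - 1) div 2) = n - (k - i) * even_ceil r - i * r"
    by (cases "even r") (simp_all add: even_ceil_def even_nat_iff algebra_simps)
  ultimately show ?thesis by (simp only:)
qed

text \<open>The argument is uniform in \<open>k\<close>, so every \<open>k \<ge> 2\<close> is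
  covered.\<close>

lemma finite_rogers_ramanujan_even:
  fixes n k i :: int
  assumes "0 \<le> n" "2 \<le> k" "1 \<le> i" "i \<le> k"
  shows "Sum_any (\<lambda>m :: int \<Rightarrow> int.
           if m \<in> decreasing_tuples (k - 1) then
             q powi ((\<Sum>j=1..k-1. (m j)\<^sup>2) + (\<Sum>j=i..k-1. m j)) *
             q_binomial' (q\<^sup>2) (n - (\<Sum>j=1..k-2. m j) - k + i) (m (k - 1)) *
             (\<Prod>j=1..k-2. qb'
                (2 * n - 2 * (\<Sum>l=1..j-1. m l) - m j - m (j + 1) - 2 * alpha i j)
                (m j - m (j + 1)))
           else 0)
       = Sum_any (\<lambda>r :: int.
           (-1) powi r * q powi (r * (k * r + k - i)) *
           qb (2 * n) (n - k * r + (k - i) * (((-1) ^ nat \<bar>r\<bar> - 1) div 2)))"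
    (is "Sum_any ?f = Sum_any ?g")
proof -
  define S where "S = {m. ?f m \<noteq> 0}"
  have "finite S"
    by (rule finite_subset[OF _ finite_support_left[OF assms(1,2,4), of q]]) (auto simp: S_def)
  \<comment> \<open>One bound for the first entry of all contributing tuples, at least
    \<open>n\<close> as the last summation demands.\<close>
  define B where "B = Max (insert n ((\<lambda>m. m 1) ` S))"
  have SB: "m 1 \<le> B" if "m \<in> S" for m
    using \<open>finite S\<close> that by (auto simp: B_def)
  have nB: "n \<le> B"
    using \<open>finite S\<close> by (simp add: B_def)
  define I where "I = {-B-2..B+2}"
  have k1: "1 \<le> k - 1" using assms by simp
  have "Sum_any ?f = sum ?f (bounded_tuples B (k - 1))"
  proof (rule Sum_any.expand_superset[OF finite_bounded_tuples[OF k1]])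
    show "{m. ?f m \<noteq> 0} \<subseteq> bounded_tuples B (k - 1)"
    proof
      fix m assume m: "m \<in> {m. ?f m \<noteq> 0}"
      then have "m \<in> decreasing_tuples (k - 1)" by (auto split: if_splits)
      moreover have "m 1 \<le> B" using m SB by (simp only: S_def)
      ultimately show "m \<in> bounded_tuples B (k - 1)" by (simp add: bounded_tuples_def)
    qed
  qed
  also have "\<dots> = (\<Sum>m\<in>bounded_tuples B (k - 1). partial_summand n k i (k - 1) m)"
    by (rule sum.cong) (simp_all add: partial_summand_last[OF assms(2,4)] bounded_tuples_def)
  also have "\<dots> = (\<Sum>v=0..B. partial_summand n k i 1 ((\<lambda>_. undefined)(1 := v)))"
    by (rule sum_partial_summand) (use assms in auto)
  also have "\<dots> = (\<Sum>b\<in>I. alt b * q powi (k * b\<^sup>2 + (k - i) * b) *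
      qb (2 * n) (n - (k - i) * even_ceil b - i * b))"
    by (rule sum_partial_summand_1) (use assms nB in \<open>auto simp: I_def\<close>)
  also have "\<dots> = Sum_any (\<lambda>b. alt b * q powi (k * b\<^sup>2 + (k - i) * b) *
      qb (2 * n) (n - (k - i) * even_ceil b - i * b))"
  proof (rule Sum_any.expand_superset[symmetric])
    show "{b. alt b * q powi (k * b\<^sup>2 + (k - i) * b) * qb (2 * n) (n - (k - i) * even_ceil b - i * b) \<noteq> 0} \<subseteq> I"
    proof
      fix b
      assume "b \<in> {b. alt b * q powi (k * b\<^sup>2 + (k - i) * b) * qb (2 * n) (n - (k - i) * even_ceil b - i * b) \<noteq> 0}"
      then have "qb (2 * n) (n - (k - i) * even_ceil b - i * b) \<noteq> 0" by auto
      then have bounds: "0 \<le> n - (k - i) * even_ceil b - i * b" "n - (k - i) * even_ceil b - i * b \<le> 2 * n"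
        by (auto dest: q_binomial_nonzeroD)
      \<comment> \<open>Both shifts have the sign of \<open>b\<close>, and \<open>i * b\<close>
        alone has absolute value at least that of \<open>b\<close>.\<close>
      have "\<bar>b\<bar> \<le> n"
      proof (cases "0 \<le> b")
        case True
        then have "0 \<le> (k - i) * even_ceil b"
          using assms even_ceil_nonneg[of b] by simp
        moreover have "1 * b \<le> i * b"
          using True assms by (intro mult_right_mono)
        ultimately show ?thesis using True bounds by linarith
      next
        case False
        then have "(k - i) * even_ceil b \<le> 0"
          using assms even_ceil_nonpos[of b] by (intro mult_nonneg_nonpos) auto
        moreover have "i * b \<le> 1 * b"
          using False assms by (intro mult_right_mono_neg) auto
        ultimately show ?thesis using False bounds by linarith
      qed
      with nB show "b \<in> I" by (auto simp: I_def)
    qed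
  qed (simp add: I_def)
  finally show ?thesis by (simp only: right_summand)
qed

end

section \<open>The case q = 0\<close>

lemma q_pochhammer_base_0 [simp]: "q_pochhammer 0 0 m = (1::'a::field)"
  by (simp add: q_pochhammer_def)

lemma q_binomial_base_0: "q_binomial (0::'a::field) a b = (if 0 \<le> b \<and> b \<le> a then 1 else 0)"
  by (simp add: q_binomial_def)

lemma q_binomial'_base_0_0: "q_binomial' (0::'a::field) a 0 = 1"
  by (simp add: q_binomial'_def q_binomial_base_0)

text \<open>A nonzero tuple has positive exponent, so only the zero tuple contributes, and its
  primed coefficients are all 1.\<close>

lemma left_sum_base_0:
  fixes n k i :: int
  assumes "2 \<le> k" "1 \<le> i"
  shows "Sum_any (\<lambda>m :: int \<Rightarrow> int.
           if m \<in> decreasing_tuples (k - 1) then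
             0 powi ((\<Sum>j=1..k-1. (m j)\<^sup>2) + (\<Sum>j=i..k-1. m j)) *
             q_binomial' (0\<^sup>2) (n - (\<Sum>j=1..k-2. m j) - k + i) (m (k - 1)) *
             (\<Prod>j=1..k-2. q_binomial' 0
                (2 * n - 2 * (\<Sum>l=1..j-1. m l) - m j - m (j + 1) - 2 * alpha i j)
                (m j - m (j + 1)))
           else 0) = (1::'a::field)" (is "Sum_any ?f = 1")
proof -
  define z :: "int \<Rightarrow> int" where "z = (\<lambda>j\<in>{1..k-1}. 0)"
  have z: "z j = 0" if "1 \<le> j" "j \<le> k - 1" for j
    using that by (simp add: z_def)
  have vanish: "?f m = 0" if "m \<noteq> z" for m
  proof (cases "m \<in> decreasing_tuples (k - 1)")
    case True
    then have m: "m \<in> {1..k-1} \<rightarrow>\<^sub>E {0..}" by (simp add: decreasing_tuples_def)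
    have "\<exists>j\<in>{1..k-1}. m j \<noteq> 0"
    proof (rule ccontr)
      assume "\<not> ?thesis"
      with m have "m = z"
        by (auto simp: z_def fun_eq_iff PiE_iff extensional_def restrict_def)
      with that show False by simp
    qed
    then obtain j where j: "j \<in> {1..k-1}" "m j \<noteq> 0" ..
    have "0 < (\<Sum>j=1..k-1. (m j)\<^sup>2)"
      by (rule sum_pos2[OF _ j(1)]) (use j in auto)
    moreover have "0 \<le> (\<Sum>j=i..k-1. m j)"
      by (rule sum_nonneg) (use m assms in \<open>auto simp: PiE_iff\<close>)
    ultimately show ?thesis by (simp add: power_int_0_left_if)
  qed simp
  have "Sum_any ?f = sum ?f {z}"
  proof (rule Sum_any.expand_superset)
    show "{m. ?f m \<noteq> 0} \<subseteq> {z}" using vanish by blast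
  qed simp
  moreover have "z \<in> decreasing_tuples (k - 1)"
    by (auto simp: decreasing_tuples_def z_def monotone_on_def)
  moreover have "(\<Sum>j=1..k-1. (z j)\<^sup>2) = 0" "(\<Sum>j=i..k-1. z j) = 0" "z (k - 1) = 0"
    using assms by (simp_all add: z)
  moreover have "(\<Prod>j=1..k-2. q_binomial' (0::'a)
      (2 * n - 2 * (\<Sum>l=1..j-1. z l) - z j - z (j + 1) - 2 * alpha i j) (z j - z (j + 1))) = 1"
    by (rule prod.neutral) (simp add: z q_binomial'_base_0_0)
  ultimately show ?thesis
    by (simp add: q_binomial'_base_0_0)
qed

lemma right_sum_base_0:
  fixes n k i :: int
  assumes "0 \<le> n" "1 \<le> i" "i \<le> k"
  shows "Sum_any (\<lambda>r :: int. (-1) powi r * 0 powi (r * (k * r + k - i)) *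
           q_binomial 0 (2 * n) (n - k * r + (k - i) * (((-1) ^ nat \<bar>r\<bar> - 1) div 2))) = (1::'a::field)"
    (is "Sum_any ?g = 1")
proof -
  have "?g r = 0" if "r \<noteq> 0" for r
  proof -
    \<comment> \<open>The root would need \<open>k * r = i - k\<close>, which lies strictly above
      \<open>-k\<close> and at most at 0, forcing \<open>r = 0\<close>.\<close>
    have "k * r + k - i \<noteq> 0"
    proof
      assume *: "k * r + k - i = 0"
      show False
      proof (cases "0 < r")
        case True
        then have "0 < k * r" using assms by simp
        with * assms show False by linarith
      next
        case False
        then have "k * r \<le> k * (-1)" using that assms by (intro mult_left_mono) auto
        with * assms show False by linarith
      qed
    qed
    with that show ?thesis by (simp add: power_int_0_left_if)
  qed
  then have "Sum_any ?g = sum ?g {0}"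
    by (intro Sum_any.expand_superset) auto
  with assms show ?thesis by (simp add: q_binomial_base_0)
qed

text \<open>The hypothesis on \<open>q\<close> admits \<open>q = 0\<close>, where negative powers do
  not obey \<open>qpow_add\<close>; there both sides are 1. Any other \<open>q\<close> satisfies
  \<open>generic_base\<close>.\<close>

theorem theorem1p7:
  fixes q :: "'a::field" and n k i :: int
  assumes "\<And>m::nat. m > 0 \<Longrightarrow> q ^ m \<noteq> 1"
    and "n \<ge> 0" and "k \<in> {2, 3, 4}" and "k \<ge> i" and "i \<ge> 1"
  shows "Sum_any (\<lambda>m :: int \<Rightarrow> int.
           if m \<in> decreasing_tuples (k - 1) then
             q powi ((\<Sum>j=1..k-1. (m j)\<^sup>2) + (\<Sum>j=i..k-1. m j)) *
             q_binomial' (q\<^sup>2) (n - (\<Sum>j=1..k-2. m j) - k + i) (m (k - 1)) *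
             (\<Prod>j=1..k-2. q_binomial' q
                (2 * n - 2 * (\<Sum>l=1..j-1. m l) - m j - m (j + 1) - 2 * alpha i j)
                (m j - m (j + 1)))
           else 0)
       = Sum_any (\<lambda>r :: int.
           (-1) powi r * q powi (r * (k * r + k - i)) *
           q_binomial q (2 * n) (n - k * r + (k - i) * (((-1) ^ nat \<bar>r\<bar> - 1) div 2)))"
proof (cases "q = 0")
  case True
  have k: "2 \<le> k" using assms(3) by auto
  show ?thesis
    unfolding True left_sum_base_0[OF k assms(5)] right_sum_base_0[OF assms(2,5,4)] ..
next
  case False
  interpret generic_base q
    by unfold_locales (use False assms(1) in auto)
  show ?thesis
    by (rule finite_rogers_ramanujan_even) (use assms in auto)
qed

end
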